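(* Let $\Gamma=(\Gamma_1,\Gamma_2,\Gamma_3)$ be a double-bubble configuration with interfacial energy $$W(\Gamma)=\sum_{j=1}^3\int_{\Gamma_j}\gamma_j(\mathbf n_j)\,d\Gamma_j-(\gamma_{VS_1}-\gamma_{F_1S_1})(x_C-x_A)-(\gamma_{VS_2}-\gamma_{F_2S_2})(x_B-x_C).$$ Assume the junction point condition $$\sum_{j=1}^{3}\left[\gamma_j(\mathbf n_j)\boldsymbol\tau_j-\left(\boldsymbol{\xi}_{j}(\mathbf n_j)\cdot\boldsymbol\tau_j\right)\mathbf n_j\right]=\mathbf 0\qquad\text{at the junction point } P .$$ Then the first variation of $W$ with respect to a smooth deformation field $\mathbf V=(\mathbf V_1,\mathbf V_2,\mathbf V_3)$, namely $\delta W(\Gamma;\mathbf V)=\lim_{\varepsilon\to0}\frac{W(\Gamma^\varepsilon)-W(\Gamma)}{\varepsilon}$, is $$\begin{aligned}\delta W(\Gamma;\mathbf V)=&-\sum_{j=1}^3\int_{\Gamma_j}\left(\partial_{s_j}\boldsymbol\xi_j^{\perp}\cdot\mathbf n_j\right)\left(\mathbf V_{j,0}\cdot\mathbf n_j\right)ds_j\\&-\Big[\big(\xi_{1,2}-(\gamma_{VS_1}-\gamma_{F_1S_1})\big)(\mathbf V_{1,0}\cdot\mathbf e_1)\Big]\Big|_{s_1=0}-\Big[\big(\xi_{2,2}+(\gamma_{VS_2}-\gamma_{F_2S_2})\big)(\mathbf V_{2,0}\cdot\mathbf e_1)\Big]\Big|_{s_2=0}\\&-\Big[\big(\xi_{3,2}+(\gamma_{VS_1}-\gamma_{F_1S_1})-(\gamma_{VS_2}-\gamma_{F_2S_2})\big)(\mathbf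 V_{3,0}\cdot\mathbf e_1)\Big]\Big|_{s_3=0}.\end{aligned}$$
   Context: Notation. $\mathbb S^1$ is the unit circle in $\mathbb R^2$, $\mathbf e_1=(1,0)$, and $(a,b)^\perp=(b,-a)$ (clockwise rotation by $90^\circ$). Configuration. The substrate is the line $\{y=0\}$. A double-bubble configuration consists of three smooth regular open curves $\Gamma_1,\Gamma_2,\Gamma_3\subset\mathbb R^2$. Each $\Gamma_j$ has length $L_j$ and arc length $s_j\in[0,L_j]$, and is also parameterized by $\rho_j\in\mathbb I_j=[0,1]$, with $\rho_j=0$ at $s_j=0$ and $\rho_j=1$ at $s_j=L_j$. The endpoints $s_1=0$, $s_2=0$, $s_3=0$ are points $A$, $B$, $C$ on the substrate, with abscissae $x_A,x_B,x_C$. The endpoints $s_j=L_j$ ($j=1,2,3$) coincide at one point $P$, the junction point. The unit tangent is $\boldsymbol\tau_j=\partial_{s_j}\mathbf X_j$ and the unit normal is $\mathbf n_j=-\boldsymbol\tau_j^\perp$. Energies. $\gamma_j\in C^2(\mathbb S^1)$, $\gamma_j>0$, is the surface energy density of $\Gamma_j$; $\gamma_{VS_1},\gamma_{VS_2},\gamma_{F_1S_1},\gamma_{F_2S_2}$ are real constants. Its homogeneous extension is $\widehat\gamma_j(\mathbf p)=|\mathbf p|\gamma_j(\mathbf p/|\mathbf p|)$ for $\mathbf p\in\mathbb R^2\setminus\{\mathbf 0\}$. The Cahn–Hoffman vector is $\boldsymbol\xi_j=\boldsymbol\xi_j(\mathbf n_j)=\nabla\widehat\gamma_j(\mathbf p)|_{\mathbf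 p=\mathbf n_j}=(\xi_{j,1},\xi_{j,2})$. Perturbations. For $\varepsilon\in[0,\varepsilon_0]$, $\Gamma_j^\varepsilon=\mathbf X_j(\rho_j,\varepsilon)$, with $\mathbf X_j:\mathbb I_j\times[0,\varepsilon_0]\to\mathbb R^2$ smooth, is a family of perturbed curves with $\Gamma_j^0=\Gamma_j$, and $\Gamma^\varepsilon=(\Gamma_1^\varepsilon,\Gamma_2^\varepsilon,\Gamma_3^\varepsilon)$ is again a double-bubble configuration: for every $\varepsilon$ the endpoints $\mathbf X_j(0,\varepsilon)$ lie on the substrate (so $\mathbf V_{j,0}|_{s_j=0}\parallel\mathbf e_1$), and $\mathbf X_1(1,\varepsilon)=\mathbf X_2(1,\varepsilon)=\mathbf X_3(1,\varepsilon)$. The deformation field is $\mathbf V_j(\rho_j,\varepsilon)=\partial_\varepsilon\mathbf X_j(\rho_j,\varepsilon)$, and $\mathbf V_{j,0}=\mathbf V_j(\rho_j,0)$. *)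

theory Defs
  imports "HOL-Analysis.Analysis"
begin

text \<open>
  \<open>C\<close>-\<open>k\<close> maps on a set, via Frechet derivatives relative to that set.  On the closed intervals and
  closed rectangles used below these derivatives are unique, and on the boundary they are the
  one-sided ones.  The derivative of \<open>f\<close> is again required to be \<open>C\<close>-\<open>k\<close> by requiring this of
  each directional derivative \<open>\<lambda>x. f' x v\<close>.
\<close>

primrec Ck_on :: "nat \<Rightarrow> ('a::real_normed_vector \<Rightarrow> 'b::real_normed_vector) \<Rightarrow> 'a set \<Rightarrow> bool" where
  "Ck_on 0 f S \<longleftrightarrow> continuous_on S f"
| "Ck_on (Suc k) f S \<longleftrightarrow>
     (\<exists>f'. (\<forall>x\<in>S. (f has_derivative f' x) (at x within S)) \<and> (\<forall>v. Ck_on k (\<lambda>x. f' x v) S))"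

definition smooth_on :: "('a::real_normed_vector \<Rightarrow> 'b::real_normed_vector) \<Rightarrow> 'a set \<Rightarrow> bool" where
  "smooth_on f S \<longleftrightarrow> (\<forall>k. Ck_on k f S)"

definition perp :: "real^2 \<Rightarrow> real^2" where
  "perp v = vector [v $ 2, - (v $ 1)]"


subsection \<open>Curves and arc length\<close>

text \<open>
  A curve is given by a parametrization over \<open>\<rho> \<in> [0,1]\<close>; values outside \<open>[0,1]\<close> are irrelevant.
  Quantities on the curve are functions of the arc length \<open>s \<in> [0,L]\<close>, and \<open>param_of X\<close> is the
  inverse \<open>s \<mapsto> \<rho>\<close> of the arc length function.
\<close>

definition arc_length :: "(real \<Rightarrow> real^2) \<Rightarrow> real \<Rightarrow> real" where
  "arc_length X \<rho> = integral {0..\<rho>} (\<lambda>r. norm (vector_derivative X (at r within {0..1})))"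

definition curve_length :: "(real \<Rightarrow> real^2) \<Rightarrow> real" where
  "curve_length X = arc_length X 1"

definition param_of :: "(real \<Rightarrow> real^2) \<Rightarrow> real \<Rightarrow> real" where
  "param_of X = the_inv_into {0..1} (arc_length X)"

definition deriv_s :: "(real \<Rightarrow> real^2) \<Rightarrow> (real \<Rightarrow> real^2) \<Rightarrow> real \<Rightarrow> real^2" where
  "deriv_s X f s = vector_derivative f (at s within {0..curve_length X})"

definition tangent :: "(real \<Rightarrow> real^2) \<Rightarrow> real \<Rightarrow> real^2" where
  "tangent X = deriv_s X (\<lambda>s. X (param_of X s))"

definition normal :: "(real \<Rightarrow> real^2) \<Rightarrow> real \<Rightarrow> real^2" where
  "normal X s = - perp (tangent X s)"

definition smooth_regular_open_curve :: "(real \<Rightarrow> real^2) \<Rightarrow> bool" where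
  "smooth_regular_open_curve X \<longleftrightarrow>
     smooth_on X {0..1} \<and>
     (\<forall>\<rho>\<in>{0..1}. vector_derivative X (at \<rho> within {0..1}) \<noteq> 0) \<and>
     X 0 \<noteq> X 1"


subsection \<open>Anisotropic surface energy\<close>

text \<open>
  A density on the unit circle is a function on the plane of which only the values on the circle
  matter; the smooth structure of the circle is that of the angle parametrization.
\<close>

definition surface_energy_density :: "(real^2 \<Rightarrow> real) \<Rightarrow> bool" where
  "surface_energy_density \<gamma> \<longleftrightarrow>
     Ck_on 2 (\<lambda>\<theta>::real. \<gamma> (vector [cos \<theta>, sin \<theta>])) UNIV \<and> (\<forall>n\<in>sphere 0 1. \<gamma> n > 0)"

definition homogeneous_extension :: "(real^2 \<Rightarrow> real) \<Rightarrow> real^2 \<Rightarrow> real" where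
  "homogeneous_extension \<gamma> p = norm p * \<gamma> (p /\<^sub>R norm p)"

definition cahn_hoffman :: "(real^2 \<Rightarrow> real) \<Rightarrow> real^2 \<Rightarrow> real^2" where
  "cahn_hoffman \<gamma> n = (THE D. GDERIV (homogeneous_extension \<gamma>) n :> D)"

text \<open>The Cahn--Hoffman vector along a curve, as a function of arc length.\<close>

definition xi :: "(real^2 \<Rightarrow> real) \<Rightarrow> (real \<Rightarrow> real^2) \<Rightarrow> real \<Rightarrow> real^2" where
  "xi \<gamma> X s = cahn_hoffman \<gamma> (normal X s)"


subsection \<open>Double bubbles\<close>

text \<open>
  The three curves are indexed by the three-element type \<open>3\<close>, whose elements are \<open>1\<close>, \<open>2\<close>
  and \<open>3\<close> (with \<open>3 = 0\<close>).  The contact points \<open>A\<close>, \<open>B\<close>, \<open>C\<close> are \<open>\<Gamma> 1 0\<close>, \<open>\<Gamma> 2 0\<close>, \<open>\<Gamma> 3 0\<close>.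
\<close>

definition double_bubble :: "(3 \<Rightarrow> real \<Rightarrow> real^2) \<Rightarrow> bool" where
  "double_bubble \<Gamma> \<longleftrightarrow>
     (\<forall>j. smooth_regular_open_curve (\<Gamma> j)) \<and>
     (\<forall>j. \<Gamma> j 0 $ 2 = 0) \<and>
     (\<exists>P. \<forall>j. \<Gamma> j 1 = P)"

definition bubble_energy ::
  "(3 \<Rightarrow> real^2 \<Rightarrow> real) \<Rightarrow> real \<Rightarrow> real \<Rightarrow> real \<Rightarrow> real \<Rightarrow> (3 \<Rightarrow> real \<Rightarrow> real^2) \<Rightarrow> real" where
  "bubble_energy \<gamma> \<gamma>VS1 \<gamma>F1S1 \<gamma>VS2 \<gamma>F2S2 \<Gamma> =
     (let xA = \<Gamma> 1 0 $ 1; xB = \<Gamma> 2 0 $ 1; xC = \<Gamma> 3 0 $ 1 in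
       (\<Sum>j\<in>UNIV. integral {0..curve_length (\<Gamma> j)} (\<lambda>s. \<gamma> j (normal (\<Gamma> j) s)))
       - (\<gamma>VS1 - \<gamma>F1S1) * (xC - xA) - (\<gamma>VS2 - \<gamma>F2S2) * (xB - xC))"

text \<open>\<open>X j \<rho> \<epsilon>\<close> is the point with parameter \<open>\<rho>\<close> on the \<open>j\<close>-th curve of the perturbed bubble.\<close>

definition smooth_perturbation ::
  "(3 \<Rightarrow> real \<Rightarrow> real^2) \<Rightarrow> real \<Rightarrow> (3 \<Rightarrow> real \<Rightarrow> real \<Rightarrow> real^2) \<Rightarrow> bool" where
  "smooth_perturbation \<Gamma> \<epsilon>0 X \<longleftrightarrow>
     0 < \<epsilon>0 \<and>
     (\<forall>j. smooth_on (\<lambda>(\<rho>, \<epsilon>). X j \<rho> \<epsilon>) ({0..1} \<times> {0..\<epsilon>0})) \<and>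
     (\<forall>j. \<forall>\<rho>\<in>{0..1}. X j \<rho> 0 = \<Gamma> j \<rho>) \<and>
     (\<forall>\<epsilon>\<in>{0..\<epsilon>0}. double_bubble (\<lambda>j \<rho>. X j \<rho> \<epsilon>))"

definition deformation_field ::
  "real \<Rightarrow> (3 \<Rightarrow> real \<Rightarrow> real \<Rightarrow> real^2) \<Rightarrow> 3 \<Rightarrow> real \<Rightarrow> real \<Rightarrow> real^2" where
  "deformation_field \<epsilon>0 X j \<rho> \<epsilon> = vector_derivative (X j \<rho>) (at \<epsilon> within {0..\<epsilon>0})"

text \<open>The initial deformation field on the unperturbed curve, as a function of arc length.\<close>

definition V0 ::
  "(3 \<Rightarrow> real \<Rightarrow> real^2) \<Rightarrow> real \<Rightarrow> (3 \<Rightarrow> real \<Rightarrow> real \<Rightarrow> real^2) \<Rightarrow> 3 \<Rightarrow> real \<Rightarrow> real^2" where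
  "V0 \<Gamma> \<epsilon>0 X j s = deformation_field \<epsilon>0 X j (param_of (\<Gamma> j) s) 0"

end

theory Submission
  imports Defs
begin

text \<open>
  In the parameter \<open>\<rho>\<close> the energy of one curve is \<open>\<integral> \<gamma>'(- X\<^sub>\<rho>\<^sup>\<bottom>) d\<rho>\<close> with \<open>\<gamma>'\<close> the homogeneous
  extension of \<open>\<gamma>\<close>, because the length element is absorbed by homogeneity.  Differentiating under
  the integral sign gives \<open>\<integral> \<xi>\<^sup>\<bottom> \<bullet> \<partial>\<^sub>\<rho>V d\<rho> = \<integral> \<xi>\<^sup>\<bottom> \<bullet> \<partial>\<^sub>sV ds\<close>, and an integration by parts in \<open>s\<close>
  produces the boundary terms \<open>\<xi>\<^sup>\<bottom> \<bullet> V\<close> and the integrand \<open>\<partial>\<^sub>s\<xi>\<^sup>\<bottom> \<bullet> V\<close>.  In polar form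
  \<open>\<xi> = g n - g' n\<^sup>\<bottom>\<close>, where \<open>g\<close> is \<open>\<gamma>\<close> as a function of the angle, hence \<open>\<partial>\<^sub>s\<xi>\<close> is tangential and
  \<open>\<partial>\<^sub>s\<xi>\<^sup>\<bottom>\<close> is normal.  At the junction the three vectors \<open>\<xi>\<^sup>\<bottom>\<close> are the summands of the junction
  condition, while the three values of \<open>V\<close> coincide, so these boundary terms cancel; on the
  substrate \<open>V\<close> is horizontal and \<open>\<xi>\<^sup>\<bottom> \<bullet> e\<^sub>1 = \<xi>\<^sub>2\<close>.
\<close>

subsection \<open>Polar coordinates\<close>

lemma perp_nth [simp]: "perp v $ 1 = v $ 2" "perp v $ 2 = - (v $ 1)"
  by (simp_all add: perp_def)

lemma inner_plane: "v \<bullet> w = v $ 1 * w $ 1 + v $ 2 * w $ 2" for v w :: "real^2"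
  by (simp add: inner_vec_def sum_2)

lemma linear_perp: "linear perp"
  by (rule linearI) (simp_all add: vec_eq_iff forall_2)

lemma bounded_linear_perp: "bounded_linear perp"
  using linear_conv_bounded_linear linear_perp by blast

lemma perp_perp [simp]: "perp (perp v) = - v"
  by (simp add: vec_eq_iff forall_2)

lemma perp_scaleR [simp]: "perp (c *\<^sub>R v) = c *\<^sub>R perp v"
  by (rule linear_scale[OF linear_perp])

lemma perp_minus [simp]: "perp (- v) = - perp v"
  by (rule linear_neg[OF linear_perp])

lemma perp_eq_0_iff [simp]: "perp v = 0 \<longleftrightarrow> v = 0"
  by (auto simp: vec_eq_iff forall_2)

lemma inner_perp_self [simp]: "v \<bullet> perp v = 0" "perp v \<bullet> v = 0"
  by (simp_all add: inner_plane)

lemma inner_perp_right: "v \<bullet> perp w = - (perp v \<bullet> w)"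
  by (simp add: inner_plane)

lemma norm_perp [simp]: "norm (perp v) = norm v"
  by (simp add: norm_eq_sqrt_inner inner_plane algebra_simps)

section \<open>The unit circle and local branches of its angle\<close>

definition circle_point :: "real \<Rightarrow> real^2" where
  "circle_point \<theta> = vector [cos \<theta>, sin \<theta>]"

lemma circle_point_nth [simp]: "circle_point \<theta> $ 1 = cos \<theta>" "circle_point \<theta> $ 2 = sin \<theta>"
  by (simp_all add: circle_point_def)

lemma norm_circle_point [simp]: "norm (circle_point \<theta>) = 1"
  by (simp add: norm_eq_sqrt_inner inner_plane flip: power2_eq_square)

lemma circle_point_inner_self [simp]: "circle_point \<theta> \<bullet> circle_point \<theta> = 1"
  by (simp add: inner_plane flip: power2_eq_square)

text \<open>\<open>perp\<close> turns clockwise while the angle runs counterclockwise, hence the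
  minus sign.\<close>

lemma has_vector_derivative_circle_point:
  "(circle_point has_vector_derivative - perp (circle_point \<theta>)) (at \<theta>)"
proof -
  have *: "circle_point = (\<lambda>\<theta>. cos \<theta> *\<^sub>R axis 1 1 + sin \<theta> *\<^sub>R axis 2 1)"
    by (auto simp: fun_eq_iff vec_eq_iff forall_2 axis_def)
  show ?thesis
    unfolding * by (auto intro!: derivative_eq_intros simp: vec_eq_iff forall_2 axis_def)
qed

lemma polar_form:
  fixes p :: "real^2"
  obtains \<theta> where "norm p *\<^sub>R circle_point \<theta> = p"
proof (cases "p = 0")
  case False
  have "(norm p)\<^sup>2 = (p $ 1)\<^sup>2 + (p $ 2)\<^sup>2"
    unfolding power2_norm_eq_inner inner_plane by (simp add: power2_eq_square)
  with False have "(p $ 1 / norm p)\<^sup>2 + (p $ 2 / norm p)\<^sup>2 = 1"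
    by (simp add: power_divide vec_eq_iff forall_2 flip: add_divide_distrib)
  then obtain \<theta> where \<theta>: "p $ 1 / norm p = cos \<theta>" "p $ 2 / norm p = sin \<theta>"
    by (rule sincos_total_2pi)
  have "norm p *\<^sub>R circle_point \<theta> = p"
    using False by (simp add: vec_eq_iff forall_2 flip: \<theta>)
  then show thesis by (rule that)
next
  case True
  then show thesis by (intro that[of 0]) simp
qed

text \<open>The branch of the angle of \<open>p\<close> that is close to \<open>\<theta>\<close>, valid on the half plane
  \<open>p \<bullet> circle_point \<theta> > 0\<close>; elsewhere it is a junk value.\<close>

definition angle_near :: "real \<Rightarrow> real^2 \<Rightarrow> real" where
  "angle_near \<theta> p = \<theta> - arctan ((p \<bullet> perp (circle_point \<theta>)) / (p \<bullet> circle_point \<theta>))"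

lemma polar_form_near:
  assumes "p \<bullet> circle_point \<theta> > 0"
  shows "norm p *\<^sub>R circle_point (angle_near \<theta> p) = p"
proof -
  \<comment> \<open>\<open>a\<close> and \<open>b\<close> are the coordinates of \<open>p\<close> in
    the orthonormal frame formed by \<open>circle_point \<theta>\<close> and its clockwise rotation.
    As \<open>a > 0\<close>, the signed clockwise angle from \<open>circle_point \<theta>\<close> to
    \<open>p\<close> is \<open>arctan (b / a)\<close>.\<close>
  define a where "a = p \<bullet> circle_point \<theta>"
  define b where "b = p \<bullet> perp (circle_point \<theta>)"
  have a: "a > 0" using assms by (simp add: a_def)
  have ab: "a = p $ 1 * cos \<theta> + p $ 2 * sin \<theta>" "b = p $ 1 * sin \<theta> - p $ 2 * cos \<theta>"
    by (simp_all add: a_def b_def inner_plane)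
  have "a * cos \<theta> + b * sin \<theta> = p $ 1 * (cos \<theta> * cos \<theta> + sin \<theta> * sin \<theta>)"
    "a * sin \<theta> - b * cos \<theta> = p $ 2 * (cos \<theta> * cos \<theta> + sin \<theta> * sin \<theta>)"
    unfolding ab by (simp_all only: algebra_simps)
  then have p: "p $ 1 = a * cos \<theta> + b * sin \<theta>" "p $ 2 = a * sin \<theta> - b * cos \<theta>"
    by simp_all
  have "a ^ 2 + b ^ 2 = (p $ 1 * p $ 1 + p $ 2 * p $ 2) * (cos \<theta> * cos \<theta> + sin \<theta> * sin \<theta>)"
    unfolding ab power2_eq_square by (simp only: algebra_simps)
  then have "norm p ^ 2 = a ^ 2 + b ^ 2"
    by (simp add: power2_norm_eq_inner inner_plane)
  then have np: "norm p = sqrt (a^2 + b^2)"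
    by (metis norm_ge_zero real_sqrt_unique)
  have "sqrt (1 + (b/a)^2) = sqrt (a^2+b^2) / a"
    using a by (simp add: power_divide real_sqrt_divide add_divide_eq_iff)
  \<comment> \<open>The cosine and sine of \<open>arctan x\<close> are 1 and x divided by the square
    root of 1 + x^2, so in this form of the norm the roots cancel.\<close>
  then have s: "norm p = a * sqrt (1 + (b/a)^2)"
    using a np by simp
  have "sqrt (1 + (b/a)^2) > 0" by (simp add: add_pos_nonneg)
  then have *: "norm p * cos (arctan (b / a)) = a" "norm p * sin (arctan (b / a)) = b"
    using a unfolding s cos_arctan sin_arctan by simp_all
  have "norm p * cos (\<theta> - arctan (b / a))
      = norm p * cos (arctan (b / a)) * cos \<theta> + norm p * sin (arctan (b / a)) * sin \<theta>"
    "norm p * sin (\<theta> - arctan (b / a))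
      = norm p * cos (arctan (b / a)) * sin \<theta> - norm p * sin (arctan (b / a)) * cos \<theta>"
    unfolding cos_diff sin_diff by (simp_all only: algebra_simps)
  then have "norm p * cos (\<theta> - arctan (b / a)) = p $ 1" "norm p * sin (\<theta> - arctan (b / a)) = p $ 2"
    unfolding * p by simp_all
  then show ?thesis
    unfolding angle_near_def a_def[symmetric] b_def[symmetric]
    by (simp add: vec_eq_iff forall_2)
qed

lemma angle_near_self: "angle_near \<theta> (r *\<^sub>R circle_point \<theta>) = \<theta>"
  by (simp add: angle_near_def)

lemma has_derivative_angle_near:
  assumes "r > 0"
  shows "(angle_near \<theta> has_derivative (\<lambda>h. - (h \<bullet> perp (circle_point \<theta>)) / r))
           (at (r *\<^sub>R circle_point \<theta>))"
proof -
  let ?p = "r *\<^sub>R circle_point \<theta>" and ?e = "perp (circle_point \<theta>)"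
  have "((\<lambda>p. (p \<bullet> ?e) / (p \<bullet> circle_point \<theta>)) has_derivative (\<lambda>h. (h \<bullet> ?e) / r)) (at ?p)"
    by (rule has_derivative_eq_rhs, rule has_derivative_divide', (rule derivative_intros)+)
       (use assms in auto)
  \<comment> \<open>At the base point the quotient is 0 by orthogonality, and arctan has slope 1
    there.\<close>
  moreover have "(arctan has_derivative (\<lambda>x. x)) (at ((?p \<bullet> ?e) / (?p \<bullet> circle_point \<theta>)))"
    using DERIV_arctan[of 0] by (simp add: has_field_derivative_def mult_1[abs_def])
  ultimately have "((\<lambda>p. arctan ((p \<bullet> ?e) / (p \<bullet> circle_point \<theta>))) has_derivative
      (\<lambda>h. (h \<bullet> ?e) / r)) (at ?p)"
    by (rule has_derivative_compose)
  from has_derivative_diff[OF has_derivative_const[of \<theta>] this] show ?thesis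
    by (simp add: angle_near_def[abs_def])
qed

text \<open>A derivative depends only on the germ of the function. This lets a local polar
  expression stand in for a globally defined function.\<close>

lemma has_derivative_cong_nhds:
  assumes "(f has_derivative f') (at x)" and eq: "\<forall>\<^sub>F y in nhds x. g y = f y"
  shows "(g has_derivative f') (at x)"
proof -
  have "\<forall>\<^sub>F y in at x. f y = g y"
    using eq unfolding eventually_at_filter by eventually_elim simp
  then show ?thesis
    using has_derivative_transform_eventually[OF assms(1), of g] eventually_nhds_x_imp_x[OF eq] by simp
qed

text \<open>The half plane on which the branch of the angle is valid is open and contains the base
  point.\<close>

lemma eventually_polar_form_near:
  assumes "r > 0"
  shows "\<forall>\<^sub>F p in nhds (r *\<^sub>R circle_point \<theta>). p \<noteq> 0 \<and> norm p *\<^sub>R circle_point (angle_near \<theta> p) = p"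
proof -
  have "open {p. p \<bullet> circle_point \<theta> > 0}"
    by (intro open_Collect_less continuous_intros)
  moreover have "r *\<^sub>R circle_point \<theta> \<in> {p. p \<bullet> circle_point \<theta> > 0}"
    using assms by simp
  ultimately have "\<forall>\<^sub>F p in nhds (r *\<^sub>R circle_point \<theta>). p \<in> {p. p \<bullet> circle_point \<theta> > 0}"
    by (rule eventually_nhds_in_open)
  then show ?thesis
    by eventually_elim (use polar_form_near in auto)
qed

subsection \<open>The Cahn--Hoffman vector\<close>

context
  fixes \<gamma> :: "real^2 \<Rightarrow> real" and g1 g2 :: "real \<Rightarrow> real"
  assumes g1: "\<And>\<theta>. ((\<lambda>\<theta>. \<gamma> (circle_point \<theta>)) has_field_derivative g1 \<theta>) (at \<theta>)"
begin

text \<open>Near the base point the extension is \<open>norm p\<close> times a function of the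
  angle. In the product rule the norm contributes the radial term; the angle contributes the
  tangential one, where the factor \<open>r\<close> cancels the \<open>1 / r\<close> of the angle's
  derivative.\<close>

lemma GDERIV_homogeneous_extension_polar:
  assumes "r > 0"
  shows "GDERIV (homogeneous_extension \<gamma>) (r *\<^sub>R circle_point \<theta>)
           :> \<gamma> (circle_point \<theta>) *\<^sub>R circle_point \<theta> - g1 \<theta> *\<^sub>R perp (circle_point \<theta>)"
proof -
  let ?p = "r *\<^sub>R circle_point \<theta>" and ?e = "perp (circle_point \<theta>)"
  have np: "norm ?p = r" using assms by simp
  have "?p \<noteq> 0" using np assms by (metis norm_zero order_less_irrefl)
  then have "(norm has_derivative (\<lambda>h. h \<bullet> sgn ?p)) (at ?p)"
    by (rule has_derivative_norm[THEN has_derivative_eq_rhs]) (simp add: fun_eq_iff inner_commute)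
  moreover have "sgn ?p = circle_point \<theta>"
    using assms by (simp add: sgn_div_norm)
  ultimately have norm: "(norm has_derivative (\<lambda>h. h \<bullet> circle_point \<theta>)) (at ?p)" by simp
  have "((\<lambda>p. \<gamma> (circle_point (angle_near \<theta> p))) has_derivative
          (\<lambda>h. g1 \<theta> * (- (h \<bullet> ?e) / r))) (at ?p)"
    by (rule has_derivative_compose[OF has_derivative_angle_near[OF assms],
          where g = "\<lambda>\<theta>. \<gamma> (circle_point \<theta>)" and g' = "(*) (g1 \<theta>)"])
      (use g1 in \<open>simp add: angle_near_self has_field_derivative_def\<close>)
  from has_derivative_mult[OF norm this]
  have "((\<lambda>p. norm p * \<gamma> (circle_point (angle_near \<theta> p))) has_derivative
      (\<lambda>h. h \<bullet> (\<gamma> (circle_point \<theta>) *\<^sub>R circle_point \<theta> - g1 \<theta> *\<^sub>R ?e))) (at ?p)"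
    by (rule has_derivative_eq_rhs) (use assms in \<open>simp add: np angle_near_self fun_eq_iff inner_diff_right\<close>)
  moreover have "\<forall>\<^sub>F p in nhds ?p. homogeneous_extension \<gamma> p = norm p * \<gamma> (circle_point (angle_near \<theta> p))"
    using eventually_polar_form_near[OF assms]
  proof eventually_elim
    case (elim p)
    have "circle_point (angle_near \<theta> p) = (norm p *\<^sub>R circle_point (angle_near \<theta> p)) /\<^sub>R norm p"
      using conjunct1[OF elim] by simp
    also have "\<dots> = p /\<^sub>R norm p"
      by (simp only: conjunct2[OF elim])
    finally show ?case by (simp add: homogeneous_extension_def)
  qed
  ultimately show ?thesis
    unfolding gderiv_def
    by (rule has_derivative_cong_nhds)
qed

text \<open>Uniqueness of gradients resolves the definite description. The value does not contain
  \<open>r\<close>, which is homogeneity of degree zero.\<close>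

lemma cahn_hoffman_polar:
  assumes "r > 0"
  shows "cahn_hoffman \<gamma> (r *\<^sub>R circle_point \<theta>)
           = \<gamma> (circle_point \<theta>) *\<^sub>R circle_point \<theta> - g1 \<theta> *\<^sub>R perp (circle_point \<theta>)"
  unfolding cahn_hoffman_def
proof (rule the_equality, rule GDERIV_homogeneous_extension_polar[OF assms])
  fix D assume "GDERIV (homogeneous_extension \<gamma>) (r *\<^sub>R circle_point \<theta>) :> D"
  note eq = has_derivative_unique[OF this[unfolded gderiv_def]
      GDERIV_homogeneous_extension_polar[OF assms, unfolded gderiv_def]]
  show "D = \<gamma> (circle_point \<theta>) *\<^sub>R circle_point \<theta> - g1 \<theta> *\<^sub>R perp (circle_point \<theta>)"
    by (rule vector_eq_ldot[THEN iffD1, OF allI], rule fun_cong[OF eq])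
qed

text \<open>Differentiating the polar formula in the angle, the two terms with \<open>g1\<close>
  along \<open>circle_point \<theta>\<close> cancel and only a multiple of its rotation remains. The
  chain rule with the derivative of the angle then gives a map of rank at most one.\<close>

lemma has_derivative_cahn_hoffman_polar:
  assumes "r > 0" and g2: "(g1 has_field_derivative g2 \<theta>) (at \<theta>)"
  shows "(cahn_hoffman \<gamma> has_derivative
           (\<lambda>h. ((\<gamma> (circle_point \<theta>) + g2 \<theta>) * (h \<bullet> perp (circle_point \<theta>)) / r) *\<^sub>R perp (circle_point \<theta>)))
           (at (r *\<^sub>R circle_point \<theta>))"
proof -
  let ?p = "r *\<^sub>R circle_point \<theta>" and ?e = "perp (circle_point \<theta>)"
  let ?F = "\<lambda>\<theta>. \<gamma> (circle_point \<theta>) *\<^sub>R circle_point \<theta> - g1 \<theta> *\<^sub>R perp (circle_point \<theta>)"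
  have "((\<lambda>\<theta>. perp (circle_point \<theta>)) has_vector_derivative circle_point \<theta>) (at \<theta>)"
    using bounded_linear.has_vector_derivative[OF bounded_linear_perp has_vector_derivative_circle_point]
    by simp
  from has_vector_derivative_diff[OF
      has_vector_derivative_scaleR[OF g1 has_vector_derivative_circle_point]
      has_vector_derivative_scaleR[OF g2 this]]
  have "(?F has_vector_derivative - (\<gamma> (circle_point \<theta>) + g2 \<theta>) *\<^sub>R ?e) (at \<theta>)"
    by (rule has_vector_derivative_eq_rhs) (simp add: algebra_simps)
  then have "((\<lambda>p. ?F (angle_near \<theta> p)) has_derivative
      (\<lambda>h. (- (h \<bullet> ?e) / r) *\<^sub>R (- (\<gamma> (circle_point \<theta>) + g2 \<theta>) *\<^sub>R ?e))) (at ?p)"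
    unfolding has_vector_derivative_def
    by (intro has_derivative_compose[OF has_derivative_angle_near[OF \<open>r > 0\<close>], where g = ?F
          and g' = "\<lambda>t. t *\<^sub>R (- (\<gamma> (circle_point \<theta>) + g2 \<theta>) *\<^sub>R ?e)"])
      (simp only: angle_near_self)
  moreover have "\<forall>\<^sub>F p in nhds ?p. cahn_hoffman \<gamma> p = ?F (angle_near \<theta> p)"
    using eventually_polar_form_near[OF \<open>r > 0\<close>]
  proof eventually_elim
    case (elim p)
    have "cahn_hoffman \<gamma> (norm p *\<^sub>R circle_point (angle_near \<theta> p)) = ?F (angle_near \<theta> p)"
      by (rule cahn_hoffman_polar) (use elim in simp)
    then show ?case by (simp only: conjunct2[OF elim])
  qed
  ultimately show ?thesis
    by (rule has_derivative_cong_nhds[THEN has_derivative_eq_rhs])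
       (simp add: fun_eq_iff vec_eq_iff algebra_simps add_divide_distrib diff_divide_distrib)
qed

end

lemma surface_energy_densityE:
  assumes "surface_energy_density \<gamma>"
  obtains g1 g2 where "\<And>\<theta>. ((\<lambda>\<theta>. \<gamma> (circle_point \<theta>)) has_field_derivative g1 \<theta>) (at \<theta>)"
    "\<And>\<theta>. (g1 has_field_derivative g2 \<theta>) (at \<theta>)"
proof -
  from assms have "Ck_on (Suc (Suc 0)) (\<lambda>\<theta>. \<gamma> (circle_point \<theta>)) UNIV"
    by (simp add: surface_energy_density_def circle_point_def numeral_2_eq_2)
  then obtain D1 where D1: "\<And>\<theta>. ((\<lambda>\<theta>. \<gamma> (circle_point \<theta>)) has_derivative D1 \<theta>) (at \<theta>)"
    and "Ck_on (Suc 0) (\<lambda>\<theta>. D1 \<theta> 1) UNIV"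
    unfolding Ck_on.simps by blast
  then obtain D2 where D2: "\<And>\<theta>. ((\<lambda>\<theta>. D1 \<theta> 1) has_derivative D2 \<theta>) (at \<theta>)"
    by (auto simp del: Ck_on.simps(1))
  \<comment> \<open>A linear map on the reals is multiplication by its value at 1, which turns
    Frechet derivatives into field derivatives.\<close>
  have *: "f' = (*) (f' 1)" if "(f has_derivative f') (at x)" for f :: "real \<Rightarrow> real" and f' x
    using real_bounded_linear has_derivative_bounded_linear[OF that] by auto
  from that[of "\<lambda>\<theta>. D1 \<theta> 1" "\<lambda>\<theta>. D2 \<theta> 1"] show thesis
    unfolding has_field_derivative_def using D1 D2 *[of _ "D1 _"] *[of _ "D2 _"] by metis
qed

section \<open>Properties of the Cahn--Hoffman vector without coordinates\<close>

context
  fixes \<gamma> :: "real^2 \<Rightarrow> real"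
  assumes density: "surface_energy_density \<gamma>"
begin

lemma GDERIV_homogeneous_extension:
  assumes "p \<noteq> 0"
  shows "GDERIV (homogeneous_extension \<gamma>) p :> cahn_hoffman \<gamma> p"
proof -
  obtain \<theta> where \<theta>: "norm p *\<^sub>R circle_point \<theta> = p" by (rule polar_form)
  obtain g1 g2 where "\<And>\<theta>. ((\<lambda>\<theta>. \<gamma> (circle_point \<theta>)) has_field_derivative g1 \<theta>) (at \<theta>)"
    "\<And>\<theta>. (g1 has_field_derivative g2 \<theta>) (at \<theta>)"
    by (rule surface_energy_densityE[OF density]) blast
  from GDERIV_homogeneous_extension_polar[OF this(1), of "norm p" \<theta>]
    cahn_hoffman_polar[OF this(1), of "norm p" \<theta>]
  show ?thesis using assms \<theta> by simp
qed

text \<open>The radius does not enter the polar formula. This allows unnormalized normals as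
  arguments later on.\<close>

lemma cahn_hoffman_scaleR:
  assumes "c > 0" "p \<noteq> 0"
  shows "cahn_hoffman \<gamma> (c *\<^sub>R p) = cahn_hoffman \<gamma> p"
proof -
  obtain \<theta> where \<theta>: "norm p *\<^sub>R circle_point \<theta> = p" by (rule polar_form)
  obtain g1 g2 where "\<And>\<theta>. ((\<lambda>\<theta>. \<gamma> (circle_point \<theta>)) has_field_derivative g1 \<theta>) (at \<theta>)"
    "\<And>\<theta>. (g1 has_field_derivative g2 \<theta>) (at \<theta>)"
    by (rule surface_energy_densityE[OF density]) blast
  note polar = cahn_hoffman_polar[OF this(1), where \<theta> = \<theta>]
  have "cahn_hoffman \<gamma> ((c * norm p) *\<^sub>R circle_point \<theta>) = cahn_hoffman \<gamma> (norm p *\<^sub>R circle_point \<theta>)"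
    using assms by (simp add: polar)
  then show ?thesis
    by (simp add: \<theta> flip: scaleR_scaleR)
qed

text \<open>This is Euler's identity for a function homogeneous of degree one, at unit vectors,
  where the extension agrees with \<open>\<gamma>\<close>.\<close>

lemma inner_cahn_hoffman_self:
  assumes "norm n = 1"
  shows "cahn_hoffman \<gamma> n \<bullet> n = \<gamma> n"
proof -
  obtain \<theta> where \<theta>: "norm n *\<^sub>R circle_point \<theta> = n" by (rule polar_form)
  obtain g1 g2 where "\<And>\<theta>. ((\<lambda>\<theta>. \<gamma> (circle_point \<theta>)) has_field_derivative g1 \<theta>) (at \<theta>)"
    "\<And>\<theta>. (g1 has_field_derivative g2 \<theta>) (at \<theta>)"
    by (rule surface_energy_densityE[OF density]) blast
  from cahn_hoffman_polar[OF this(1), of 1 \<theta>] show ?thesis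
    using \<theta> assms by (simp add: inner_diff_left dot_square_norm)
qed

text \<open>Only the direction of the derivative matters in the sequel, so its coefficient is hidden
  in \<open>k\<close>.\<close>

lemma has_derivative_cahn_hoffman:
  assumes "p \<noteq> 0"
  obtains k where "(cahn_hoffman \<gamma> has_derivative (\<lambda>h. (k * (h \<bullet> perp p)) *\<^sub>R perp p)) (at p)"
proof -
  obtain \<theta> where \<theta>: "norm p *\<^sub>R circle_point \<theta> = p" by (rule polar_form)
  obtain g1 g2 where "\<And>\<theta>. ((\<lambda>\<theta>. \<gamma> (circle_point \<theta>)) has_field_derivative g1 \<theta>) (at \<theta>)"
    and "\<And>\<theta>. (g1 has_field_derivative g2 \<theta>) (at \<theta>)"
    by (rule surface_energy_densityE[OF density]) blast
  from has_derivative_cahn_hoffman_polar[OF this(1) _ this(2), where r = "norm p" and \<theta> = \<theta>]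
  have D: "(cahn_hoffman \<gamma> has_derivative (\<lambda>h. ((\<gamma> (circle_point \<theta>) + g2 \<theta>) *
     (h \<bullet> perp (circle_point \<theta>)) / norm p) *\<^sub>R perp (circle_point \<theta>))) (at p)"
    using assms \<theta> by simp
  have perp_p: "perp p = norm p *\<^sub>R perp (circle_point \<theta>)"
    using perp_scaleR[of "norm p" "circle_point \<theta>"] by (simp only: \<theta>)
  \<comment> \<open>The cube collects one factor from the derivative of the angle and one from each
    of the two vectors \<open>perp p\<close>, whose length is \<open>norm p\<close>.\<close>
  have "((\<gamma> (circle_point \<theta>) + g2 \<theta>) * (h \<bullet> perp (circle_point \<theta>)) / norm p) *\<^sub>R perp (circle_point \<theta>)
      = ((\<gamma> (circle_point \<theta>) + g2 \<theta>) / norm p ^ 3 * (h \<bullet> perp p)) *\<^sub>R perp p" for h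
    unfolding perp_p using assms by (simp add: power3_eq_cube)
  then show thesis
    using D by (intro that[of "(\<gamma> (circle_point \<theta>) + g2 \<theta>) / norm p ^ 3"]) (simp only:)
qed

lemma continuous_on_homogeneous_extension: "continuous_on (- {0}) (homogeneous_extension \<gamma>)"
  by (intro continuous_at_imp_continuous_on ballI has_derivative_continuous)
     (use GDERIV_homogeneous_extension in \<open>auto simp: gderiv_def\<close>)

lemma continuous_on_cahn_hoffman: "continuous_on (- {0}) (cahn_hoffman \<gamma>)"
  by (intro continuous_at_imp_continuous_on ballI)
     (auto intro: has_derivative_cahn_hoffman has_derivative_continuous)

end

subsection \<open>Arc length\<close>

lemma Ck_on_cong:
  assumes "Ck_on k f S" "\<And>x. x \<in> S \<Longrightarrow> g x = f x"
  shows "Ck_on k g S"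
proof (cases k)
  case 0
  with assms show ?thesis by (simp cong: continuous_on_cong)
next
  case (Suc m)
  with assms(1) obtain f' where f': "\<And>x. x \<in> S \<Longrightarrow> (f has_derivative f' x) (at x within S)"
    "\<And>v. Ck_on m (\<lambda>x. f' x v) S"
    by (auto simp del: Ck_on.simps(1))
  have "(g has_derivative f' x) (at x within S)" if "x \<in> S" for x
    using has_derivative_transform[OF that assms(2) f'(1)[OF that]] by blast
  with f'(2) Suc show ?thesis
    by (simp only: Ck_on.simps) blast
qed

text \<open>A Frechet derivative in one variable is determined by its value at 1, and on a
  nondegenerate interval it is unique, so it can be identified with
  \<open>vector_derivative\<close>.\<close>

lemma Ck_on_vector_derivative:
  fixes f :: "real \<Rightarrow> 'a::euclidean_space"
  assumes "Ck_on (Suc k) f {a..b}" "a < b"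
  shows "Ck_on k (\<lambda>x. vector_derivative f (at x within {a..b})) {a..b}"
    and "x \<in> {a..b} \<Longrightarrow> (f has_vector_derivative vector_derivative f (at x within {a..b})) (at x within {a..b})"
proof -
  obtain f' where f': "\<And>x. x \<in> {a..b} \<Longrightarrow> (f has_derivative f' x) (at x within {a..b})"
    "\<And>v. Ck_on k (\<lambda>x. f' x v) {a..b}"
    using assms(1) unfolding Ck_on.simps by blast
  have vd: "(f has_vector_derivative f' x 1) (at x within {a..b})" if "x \<in> {a..b}" for x
  proof -
    have "f' x t = t *\<^sub>R f' x 1" for t
      using linear_scale[OF has_derivative_linear[OF f'(1)[OF that]], of t 1] by simp
    then have "f' x = (\<lambda>t. t *\<^sub>R f' x 1)" by (rule ext)
    with f'(1)[OF that] show ?thesis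
      unfolding has_vector_derivative_def by (simp only:)
  qed
  have eq: "vector_derivative f (at x within {a..b}) = f' x 1" if "x \<in> {a..b}" for x
    by (rule vector_derivative_within_closed_interval[OF \<open>a < b\<close> that vd[OF that]])
  show "Ck_on k (\<lambda>x. vector_derivative f (at x within {a..b})) {a..b}"
    by (rule Ck_on_cong[OF f'(2) eq])
  show "(f has_vector_derivative vector_derivative f (at x within {a..b})) (at x within {a..b})"
    if "x \<in> {a..b}"
    using vd[OF that] eq[OF that] by (simp only:)
qed

abbreviation velocity :: "(real \<Rightarrow> real^2) \<Rightarrow> real \<Rightarrow> real^2" where
  "velocity Y \<rho> \<equiv> vector_derivative Y (at \<rho> within {0..1})"

section \<open>Arc length as a change of parameter on a regular curve\<close>

context
  fixes Y :: "real \<Rightarrow> real^2"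
  assumes curve: "smooth_regular_open_curve Y"
begin

lemma velocity_nonzero: "\<rho> \<in> {0..1} \<Longrightarrow> velocity Y \<rho> \<noteq> 0"
  using curve unfolding smooth_regular_open_curve_def by blast

lemma Ck_on_curve: "Ck_on k Y {0..1}"
  using curve unfolding smooth_regular_open_curve_def smooth_on_def by blast

lemma has_vector_derivative_curve:
  "\<rho> \<in> {0..1} \<Longrightarrow> (Y has_vector_derivative velocity Y \<rho>) (at \<rho> within {0..1})"
  by (rule Ck_on_vector_derivative(2)[OF Ck_on_curve]) simp

lemma has_vector_derivative_velocity:
  "\<rho> \<in> {0..1} \<Longrightarrow> (velocity Y has_vector_derivative velocity (velocity Y) \<rho>) (at \<rho> within {0..1})"
  by (rule Ck_on_vector_derivative(2)[OF Ck_on_vector_derivative(1)[OF Ck_on_curve]]) simp_all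

lemma continuous_on_velocity: "continuous_on {0..1} (velocity Y)"
  using Ck_on_vector_derivative(1)[OF Ck_on_curve[of "Suc 0"]] by simp

lemma has_real_derivative_arc_length:
  assumes "\<rho> \<in> {0..1}"
  shows "(arc_length Y has_real_derivative norm (velocity Y \<rho>)) (at \<rho> within {0..1})"
  unfolding arc_length_def
  by (rule integral_has_real_derivative[OF continuous_on_norm[OF continuous_on_velocity] assms])

lemma arc_length_0 [simp]: "arc_length Y 0 = 0"
  by (simp add: arc_length_def)

lemma continuous_on_arc_length: "continuous_on {0..1} (arc_length Y)"
  by (rule DERIV_continuous_on[OF has_real_derivative_arc_length])

text \<open>Regularity makes the derivative of the arc length, the speed, positive.\<close>

lemma arc_length_less:
  assumes "0 \<le> a" "a < b" "b \<le> 1"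
  shows "arc_length Y a < arc_length Y b"
proof (rule DERIV_pos_imp_increasing_open[OF \<open>a < b\<close>])
  fix x assume x: "a < x" "x < b"
  with assms have "x \<in> {0<..<1}" "x \<in> {0..1}" by auto
  then have "(arc_length Y has_real_derivative norm (velocity Y x)) (at x)"
    using has_real_derivative_arc_length[of x] by (simp add: at_within_Icc_at)
  moreover have "norm (velocity Y x) > 0"
    using velocity_nonzero[OF \<open>x \<in> {0..1}\<close>] by simp
  ultimately show "\<exists>y. (arc_length Y has_real_derivative y) (at x) \<and> y > 0" by blast
next
  show "continuous_on {a..b} (arc_length Y)"
    by (rule continuous_on_subset[OF continuous_on_arc_length]) (use assms in auto)
qed

text \<open>Injectivity gives \<open>the_inv_into\<close> in \<open>param_of\<close> its intended
  meaning.\<close>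

lemma inj_on_arc_length: "inj_on (arc_length Y) {0..1}"
proof (rule linorder_inj_onI')
  fix a b :: real assume "a \<in> {0..1}" "b \<in> {0..1}" "a < b"
  then show "arc_length Y a \<noteq> arc_length Y b"
    using arc_length_less[of a b] by simp
qed

lemma curve_length_pos: "curve_length Y > 0"
  unfolding curve_length_def using arc_length_less[of 0 1] by simp

lemma image_arc_length: "arc_length Y ` {0..1} = {0..curve_length Y}"
proof
  have le: "arc_length Y a \<le> arc_length Y b" if "0 \<le> a" "a \<le> b" "b \<le> 1" for a b
    using arc_length_less[of a b] that by (cases "a = b") auto
  show "arc_length Y ` {0..1} \<subseteq> {0..curve_length Y}"
    using le[of 0] le[of _ 1] by (auto simp: curve_length_def)
  show "{0..curve_length Y} \<subseteq> arc_length Y ` {0..1}"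
  proof
    fix s assume "s \<in> {0..curve_length Y}"
    then have "\<exists>x\<ge>0. x \<le> 1 \<and> arc_length Y x = s"
      by (intro IVT' continuous_on_arc_length) (auto simp: curve_length_def)
    then show "s \<in> arc_length Y ` {0..1}" by force
  qed
qed

lemma arc_length_mem: "\<rho> \<in> {0..1} \<Longrightarrow> arc_length Y \<rho> \<in> {0..curve_length Y}"
  using image_arc_length by blast

lemma param_of_arc_length [simp]: "\<rho> \<in> {0..1} \<Longrightarrow> param_of Y (arc_length Y \<rho>) = \<rho>"
  unfolding param_of_def by (rule the_inv_into_f_f[OF inj_on_arc_length])

lemma image_param_of: "param_of Y ` {0..curve_length Y} = {0..1}"
proof -
  have "param_of Y ` arc_length Y ` {0..1} = {0..1}"
    by (simp add: image_image)
  then show ?thesis by (simp only: image_arc_length)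
qed

lemma param_of_mem: "s \<in> {0..curve_length Y} \<Longrightarrow> param_of Y s \<in> {0..1}"
  using image_param_of by blast

lemma arc_length_param_of: "s \<in> {0..curve_length Y} \<Longrightarrow> arc_length Y (param_of Y s) = s"
  unfolding param_of_def by (intro f_the_inv_into_f inj_on_arc_length) (simp only: image_arc_length)

lemma param_of_0 [simp]: "param_of Y 0 = 0"
  using param_of_arc_length[of 0] by simp

lemma param_of_curve_length [simp]: "param_of Y (curve_length Y) = 1"
  unfolding curve_length_def by (rule param_of_arc_length) simp

text \<open>The inverse of a continuous injection on a compact set is continuous.\<close>

lemma continuous_on_param_of: "continuous_on {0..curve_length Y} (param_of Y)"
proof -
  have "continuous_on (arc_length Y ` {0..1}) (param_of Y)"
    by (rule continuous_on_inv[OF continuous_on_arc_length]) auto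
  then show ?thesis by (simp only: image_arc_length)
qed

text \<open>The inverse function rule is applied relative to the interval, so that both ends are
  covered by one-sided derivatives; the speed is nonzero there as well.\<close>

lemma has_vector_derivative_param_of:
  assumes "s \<in> {0..curve_length Y}"
  shows "(param_of Y has_vector_derivative 1 / norm (velocity Y (param_of Y s)))
           (at s within {0..curve_length Y})"
proof -
  define \<rho> where "\<rho> = param_of Y s"
  have \<rho>: "\<rho> \<in> {0..1}" and s: "arc_length Y \<rho> = s"
    using assms by (simp_all only: \<rho>_def param_of_mem arc_length_param_of)
  have "(param_of Y has_derivative (\<lambda>t. t *\<^sub>R (1 / norm (velocity Y \<rho>))))
          (at (arc_length Y \<rho>) within arc_length Y ` {0..1})"
  proof (rule has_derivative_inverse_within)
    show "(arc_length Y has_derivative (*) (norm (velocity Y \<rho>))) (at \<rho> within {0..1})"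
      using has_real_derivative_arc_length[OF \<rho>] by (simp only: has_field_derivative_def)
    show "continuous (at (arc_length Y \<rho>) within arc_length Y ` {0..1}) (param_of Y)"
      using continuous_on_param_of assms
      by (simp only: image_arc_length s continuous_on_eq_continuous_within)
    show "linear (\<lambda>t. t *\<^sub>R (1 / norm (velocity Y \<rho>)))"
      by (intro linear_scale_left)
    show "(\<lambda>t. t *\<^sub>R (1 / norm (velocity Y \<rho>))) \<circ> (*) (norm (velocity Y \<rho>)) = id"
      using velocity_nonzero[OF \<rho>] by (simp add: fun_eq_iff)
  qed (use \<rho> in auto)
  then show ?thesis
    by (simp only: has_vector_derivative_def image_arc_length s flip: \<rho>_def)
qed

lemma has_vector_derivative_along_curve:
  assumes "s \<in> {0..curve_length Y}"
    and "(f has_vector_derivative f') (at (param_of Y s) within {0..1})"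
  shows "((\<lambda>s. f (param_of Y s)) has_vector_derivative f' /\<^sub>R norm (velocity Y (param_of Y s)))
           (at s within {0..curve_length Y})"
  using vector_diff_chain_within[OF has_vector_derivative_param_of[OF assms(1)], of f f'] assms(2)
  by (simp add: image_param_of o_def divide_inverse)

lemma tangent_eq:
  assumes "s \<in> {0..curve_length Y}"
  shows "tangent Y s = velocity Y (param_of Y s) /\<^sub>R norm (velocity Y (param_of Y s))"
  unfolding tangent_def deriv_s_def
  by (rule vector_derivative_within_closed_interval[OF curve_length_pos assms]
      has_vector_derivative_along_curve has_vector_derivative_curve param_of_mem assms)+

lemma norm_tangent: "s \<in> {0..curve_length Y} \<Longrightarrow> norm (tangent Y s) = 1"
  using velocity_nonzero[OF param_of_mem] by (simp add: tangent_eq)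

lemma norm_normal: "s \<in> {0..curve_length Y} \<Longrightarrow> norm (normal Y s) = 1"
  by (simp add: normal_def norm_tangent)

lemma normal_eq:
  assumes "s \<in> {0..curve_length Y}"
  shows "normal Y s = - perp (velocity Y (param_of Y s)) /\<^sub>R norm (velocity Y (param_of Y s))"
  by (simp add: normal_def tangent_eq[OF assms])

lemma continuous_on_along_curve:
  assumes "continuous_on {0..1} f"
  shows "continuous_on {0..curve_length Y} (\<lambda>s. f (param_of Y s))"
  by (rule continuous_on_compose2[OF assms continuous_on_param_of])
     (use image_param_of in blast)

lemma continuous_on_normal: "continuous_on {0..curve_length Y} (normal Y)"
proof -
  have "continuous_on {0..1} (\<lambda>\<rho>. - perp (velocity Y \<rho>) /\<^sub>R norm (velocity Y \<rho>))"
    by (intro continuous_intros continuous_on_velocity bounded_linear.continuous_on[OF bounded_linear_perp])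
       (use velocity_nonzero in auto)
  from continuous_on_along_curve[OF this] show ?thesis
    by (rule continuous_on_eq) (simp add: normal_eq)
qed

lemma integral_arc_length:
  fixes f :: "real \<Rightarrow> real"
  assumes "continuous_on {0..curve_length Y} f"
  shows "integral {0..curve_length Y} f = integral {0..1} (\<lambda>\<rho>. norm (velocity Y \<rho>) * f (arc_length Y \<rho>))"
proof -
  have "((\<lambda>\<rho>. norm (velocity Y \<rho>) *\<^sub>R f (arc_length Y \<rho>)) has_integral
          integral {arc_length Y 0..arc_length Y 1} f) {0..1}"
  proof (rule has_integral_substitution)
    show "arc_length Y ` {0..1} \<subseteq> {0..curve_length Y}"
      by (simp only: image_arc_length)
  qed (use assms has_real_derivative_arc_length curve_length_pos in \<open>auto simp: curve_length_def\<close>)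
  then show ?thesis
    by (simp add: integral_unique curve_length_def)
qed

end

subsection \<open>Families of curves\<close>

text \<open>The total derivative is composed with the embeddings of \<open>A\<close> and
  \<open>B\<close> as lines of the product, which gives one-sided partial derivatives on the
  boundary.\<close>

lemma has_vector_derivative_partial:
  assumes "\<And>x. x \<in> A \<times> B \<Longrightarrow> (f has_derivative D x) (at x within A \<times> B)" "a \<in> A" "b \<in> B"
  shows "((\<lambda>x. f (x, b)) has_vector_derivative D (a, b) (1, 0)) (at a within A)"
    and "((\<lambda>y. f (a, y)) has_vector_derivative D (a, b) (0, 1)) (at b within B)"
proof -
  have ab: "(a, b) \<in> A \<times> B" using assms by simp
  have lin: "D (a, b) (t *\<^sub>R v) = t *\<^sub>R D (a, b) v" for t v
    by (rule linear_scale[OF has_derivative_linear[OF assms(1)[OF ab]]])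
  have "((\<lambda>x. f (x, b)) has_derivative (\<lambda>t. D (a, b) (t, 0))) (at a within A)"
    by (rule has_derivative_in_compose2[where t = "A \<times> B" and g' = D])
       (use assms in \<open>auto intro!: derivative_eq_intros\<close>)
  then show "((\<lambda>x. f (x, b)) has_vector_derivative D (a, b) (1, 0)) (at a within A)"
    unfolding has_vector_derivative_def lin[symmetric] by simp
  have "((\<lambda>y. f (a, y)) has_derivative (\<lambda>t. D (a, b) (0, t))) (at b within B)"
    by (rule has_derivative_in_compose2[where t = "A \<times> B" and g' = D])
       (use assms in \<open>auto intro!: derivative_eq_intros\<close>)
  then show "((\<lambda>y. f (a, y)) has_vector_derivative D (a, b) (0, 1)) (at b within B)"
    unfolding has_vector_derivative_def lin[symmetric] by simp
qed

text \<open>The partial derivatives are kept as named functions. Only one order of mixed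
  differentiation is assumed; the other is derived below. Joint continuity serves differentiation
  under the integral sign.\<close>

locale curve_family =
  fixes F :: "real \<Rightarrow> real \<Rightarrow> real^2" and e :: real
    and F\<rho> F\<epsilon> F\<rho>\<epsilon> :: "real \<Rightarrow> real \<Rightarrow> real^2"
  assumes e_pos: "0 < e"
    and F\<rho>: "\<And>\<rho> \<epsilon>. \<lbrakk>\<rho> \<in> {0..1}; \<epsilon> \<in> {0..e}\<rbrakk>
      \<Longrightarrow> ((\<lambda>\<rho>. F \<rho> \<epsilon>) has_vector_derivative F\<rho> \<rho> \<epsilon>) (at \<rho> within {0..1})"
    and F\<epsilon>: "\<And>\<rho> \<epsilon>. \<lbrakk>\<rho> \<in> {0..1}; \<epsilon> \<in> {0..e}\<rbrakk>
      \<Longrightarrow> (F \<rho> has_vector_derivative F\<epsilon> \<rho> \<epsilon>) (at \<epsilon> within {0..e})"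
    and F\<rho>\<epsilon>: "\<And>\<rho> \<epsilon>. \<lbrakk>\<rho> \<in> {0..1}; \<epsilon> \<in> {0..e}\<rbrakk>
      \<Longrightarrow> (F\<rho> \<rho> has_vector_derivative F\<rho>\<epsilon> \<rho> \<epsilon>) (at \<epsilon> within {0..e})"
    and continuous_F\<rho>: "continuous_on ({0..1} \<times> {0..e}) (\<lambda>(\<rho>, \<epsilon>). F\<rho> \<rho> \<epsilon>)"
    and continuous_F\<rho>\<epsilon>: "continuous_on ({0..1} \<times> {0..e}) (\<lambda>(\<rho>, \<epsilon>). F\<rho>\<epsilon> \<rho> \<epsilon>)"

lemma curve_familyE:
  assumes "smooth_on (\<lambda>(\<rho>, \<epsilon>). F \<rho> \<epsilon>) ({0..1} \<times> {0..e})" "0 < e"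
  obtains F\<rho> F\<epsilon> F\<rho>\<epsilon> where "curve_family F e F\<rho> F\<epsilon> F\<rho>\<epsilon>"
proof -
  let ?R = "{0..1} \<times> {0..e}"
  \<comment> \<open>Two orders suffice: \<open>D\<close> supplies both first partials, and the
    derivative \<open>D'\<close> of the first partial in \<rho> supplies the mixed one.\<close>
  have "Ck_on (Suc (Suc 0)) (\<lambda>(\<rho>, \<epsilon>). F \<rho> \<epsilon>) ?R"
    using assms(1) unfolding smooth_on_def by blast
  then obtain D where D: "\<And>x. x \<in> ?R \<Longrightarrow> ((\<lambda>(\<rho>, \<epsilon>). F \<rho> \<epsilon>) has_derivative D x) (at x within ?R)"
    and "Ck_on (Suc 0) (\<lambda>x. D x (1, 0)) ?R"
    unfolding Ck_on.simps by blast
  then obtain D' where D': "\<And>x. x \<in> ?R \<Longrightarrow> ((\<lambda>x. D x (1, 0)) has_derivative D' x) (at x within ?R)"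
    and D'_cont: "continuous_on ?R (\<lambda>x. D' x (0, 1))"
    unfolding Ck_on.simps by blast
  show thesis
  proof (rule that, unfold_locales)
    show "continuous_on ?R (\<lambda>(\<rho>, \<epsilon>). D (\<rho>, \<epsilon>) (1, 0))"
      using has_derivative_continuous_on[of ?R "\<lambda>x. D x (1, 0)" D'] D'
      by (simp add: case_prod_unfold)
    show "continuous_on ?R (\<lambda>(\<rho>, \<epsilon>). D' (\<rho>, \<epsilon>) (0, 1))"
      using D'_cont by (simp add: case_prod_unfold)
    fix \<rho> \<epsilon> :: real assume mem: "\<rho> \<in> {0..1}" "\<epsilon> \<in> {0..e}"
    show "((\<lambda>\<rho>. F \<rho> \<epsilon>) has_vector_derivative D (\<rho>, \<epsilon>) (1, 0)) (at \<rho> within {0..1})"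
      using has_vector_derivative_partial(1)[OF D mem] by simp
    show "(F \<rho> has_vector_derivative D (\<rho>, \<epsilon>) (0, 1)) (at \<epsilon> within {0..e})"
      using has_vector_derivative_partial(2)[OF D mem] by simp
    show "((\<lambda>\<epsilon>. D (\<rho>, \<epsilon>) (1, 0)) has_vector_derivative D' (\<rho>, \<epsilon>) (0, 1)) (at \<epsilon> within {0..e})"
      using has_vector_derivative_partial(2)[OF D' mem] by simp
  qed (rule assms)
qed

context curve_family
begin

text \<open>The Leibniz rules expect the parameter before the integration variable.\<close>

lemma continuous_on_swapped:
  "continuous_on ({0..e} \<times> {0..1}) (\<lambda>(\<epsilon>, \<rho>). F\<rho> \<rho> \<epsilon>)"
  "continuous_on ({0..e} \<times> {0..1}) (\<lambda>(\<epsilon>, \<rho>). F\<rho>\<epsilon> \<rho> \<epsilon>)"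
proof -
  have swap: "prod.swap ` ({0..e} \<times> {0..1}) \<subseteq> {0..1} \<times> {0..e}" by auto
  show "continuous_on ({0..e} \<times> {0..1}) (\<lambda>(\<epsilon>, \<rho>). F\<rho> \<rho> \<epsilon>)"
    using continuous_on_compose2[OF continuous_F\<rho> continuous_on_swap swap]
    by (simp add: case_prod_unfold)
  show "continuous_on ({0..e} \<times> {0..1}) (\<lambda>(\<epsilon>, \<rho>). F\<rho>\<epsilon> \<rho> \<epsilon>)"
    using continuous_on_compose2[OF continuous_F\<rho>\<epsilon> continuous_on_swap swap]
    by (simp add: case_prod_unfold)
qed

lemma continuous_on_slice:
  assumes "\<epsilon> \<in> {0..e}"
  shows "continuous_on {0..1} (\<lambda>\<rho>. F\<rho> \<rho> \<epsilon>)" "continuous_on {0..1} (\<lambda>\<rho>. F\<rho>\<epsilon> \<rho> \<epsilon>)"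
proof -
  have pair: "continuous_on {0..1} (\<lambda>\<rho>::real. (\<rho>, \<epsilon>))" "(\<lambda>\<rho>. (\<rho>, \<epsilon>)) ` {0..1} \<subseteq> {0..1} \<times> {0..e}"
    using assms by (auto intro!: continuous_intros)
  show "continuous_on {0..1} (\<lambda>\<rho>. F\<rho> \<rho> \<epsilon>)" "continuous_on {0..1} (\<lambda>\<rho>. F\<rho>\<epsilon> \<rho> \<epsilon>)"
    using continuous_on_compose2[OF continuous_F\<rho> pair] continuous_on_compose2[OF continuous_F\<rho>\<epsilon> pair]
    by simp_all
qed

lemma vector_derivative_F\<epsilon>:
  "\<rho> \<in> {0..1} \<Longrightarrow> \<epsilon> \<in> {0..e} \<Longrightarrow> vector_derivative (F \<rho>) (at \<epsilon> within {0..e}) = F\<epsilon> \<rho> \<epsilon>"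
  by (rule vector_derivative_within_closed_interval[OF e_pos _ F\<epsilon>])

text \<open>The mixed partial derivatives are interchanged by differentiating
  \<open>F \<rho> \<epsilon> - F 0 \<epsilon> = \<integral>\<^sub>0\<^sup>\<rho> F\<rho> r \<epsilon> dr\<close> under the integral sign.\<close>

lemma has_vector_derivative_F\<epsilon>:
  assumes "\<rho> \<in> {0..1}" "\<epsilon> \<in> {0..e}"
  shows "((\<lambda>\<rho>. F\<epsilon> \<rho> \<epsilon>) has_vector_derivative F\<rho>\<epsilon> \<rho> \<epsilon>) (at \<rho> within {0..1})"
proof -
  have F\<epsilon>_eq: "F\<epsilon> r \<epsilon> = F\<epsilon> 0 \<epsilon> + integral {0..r} (\<lambda>t. F\<rho>\<epsilon> t \<epsilon>)" if r: "r \<in> {0..1}" for r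
  proof -
    have sub: "{0..r} \<subseteq> {0..1}" using r by auto
    have "((\<lambda>\<epsilon>. integral (cbox 0 r) (\<lambda>t. F\<rho> t \<epsilon>)) has_vector_derivative
        integral (cbox 0 r) (\<lambda>t. F\<rho>\<epsilon> t \<epsilon>)) (at \<epsilon> within {0..e})"
    proof (rule leibniz_rule_vector_derivative)
      show "((\<lambda>x. F\<rho> t x) has_vector_derivative F\<rho>\<epsilon> t x) (at x within {0..e})"
        if "x \<in> {0..e}" "t \<in> cbox 0 r" for x t
        using F\<rho>\<epsilon> that sub by auto
      show "(\<lambda>t. F\<rho> t x) integrable_on cbox 0 r" if "x \<in> {0..e}" for x
        using continuous_on_subset[OF continuous_on_slice(1)[OF that] sub]
        by (simp add: integrable_continuous_interval)
      show "continuous_on ({0..e} \<times> cbox 0 r) (\<lambda>(x, t). F\<rho>\<epsilon> t x)"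
        by (rule continuous_on_subset[OF continuous_on_swapped(2)]) (use sub in auto)
    qed (use assms in auto)
    moreover have "F r x - F 0 x = integral (cbox 0 r) (\<lambda>t. F\<rho> t x)" if "x \<in> {0..e}" for x
    proof -
      have "((\<lambda>t. F\<rho> t x) has_integral F r x - F 0 x) {0..r}"
        by (rule fundamental_theorem_of_calculus)
           (use r in \<open>auto intro!: has_vector_derivative_within_subset[OF F\<rho>[OF _ that] sub]\<close>)
      then show ?thesis by (simp add: integral_unique)
    qed
    ultimately have 1: "((\<lambda>x. F r x - F 0 x) has_vector_derivative integral (cbox 0 r) (\<lambda>t. F\<rho>\<epsilon> t \<epsilon>))
        (at \<epsilon> within {0..e})"
      by (rule has_vector_derivative_transform[OF assms(2), rotated])
    have 2: "((\<lambda>x. F r x - F 0 x) has_vector_derivative F\<epsilon> r \<epsilon> - F\<epsilon> 0 \<epsilon>) (at \<epsilon> within {0..e})"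
      by (intro has_vector_derivative_diff F\<epsilon> assms r) simp
    have "integral (cbox 0 r) (\<lambda>t. F\<rho>\<epsilon> t \<epsilon>) = F\<epsilon> r \<epsilon> - F\<epsilon> 0 \<epsilon>"
      by (rule trans[OF vector_derivative_within_closed_interval[OF e_pos assms(2) 1, symmetric]
            vector_derivative_within_closed_interval[OF e_pos assms(2) 2]])
    then show ?thesis by simp
  qed
  \<comment> \<open>Differentiating the integral in its upper limit returns the integrand, the mixed
    partial.\<close>
  have "((\<lambda>r. F\<epsilon> 0 \<epsilon> + integral {0..r} (\<lambda>t. F\<rho>\<epsilon> t \<epsilon>)) has_vector_derivative 0 + F\<rho>\<epsilon> \<rho> \<epsilon>)
      (at \<rho> within {0..1})"
    by (intro has_vector_derivative_add has_vector_derivative_const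
        integral_has_vector_derivative continuous_on_slice assms)
  from has_vector_derivative_transform[OF assms(1) F\<epsilon>_eq this] show ?thesis
    by (simp only: add_0)
qed

end

subsection \<open>First variation\<close>

lemma xi_eq:
  assumes "surface_energy_density \<gamma>" "smooth_regular_open_curve Y" "s \<in> {0..curve_length Y}"
  shows "xi \<gamma> Y s = cahn_hoffman \<gamma> (- perp (velocity Y (param_of Y s)))"
proof -
  have "velocity Y (param_of Y s) \<noteq> 0"
    using assms velocity_nonzero param_of_mem by blast
  then show ?thesis
    using cahn_hoffman_scaleR[OF assms(1), of "inverse (norm (velocity Y (param_of Y s)))"
        "- perp (velocity Y (param_of Y s))"]
    by (simp add: xi_def normal_eq[OF assms(2,3)])
qed

lemma integral_density_eq:
  assumes "surface_energy_density \<gamma>" and Y: "smooth_regular_open_curve Y"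
  shows "integral {0..curve_length Y} (\<lambda>s. \<gamma> (normal Y s))
           = integral {0..1} (\<lambda>\<rho>. homogeneous_extension \<gamma> (- perp (velocity Y \<rho>)))"
proof -
  have extension: "homogeneous_extension \<gamma> (normal Y s) = \<gamma> (normal Y s)"
    if "s \<in> {0..curve_length Y}" for s
    using norm_normal[OF Y that] by (simp add: homogeneous_extension_def)
  \<comment> \<open>Off the circle \<open>\<gamma>\<close> is arbitrary, so continuity along the
    unit normals is obtained from the extension, which agrees with \<open>\<gamma>\<close> on
    them.\<close>
  have "continuous_on {0..curve_length Y} (\<lambda>s. homogeneous_extension \<gamma> (normal Y s))"
    by (rule continuous_on_compose2[OF continuous_on_homogeneous_extension[OF assms(1)] continuous_on_normal[OF Y]])
       (use norm_normal[OF Y] in force)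
  then have "continuous_on {0..curve_length Y} (\<lambda>s. \<gamma> (normal Y s))"
    by (rule continuous_on_eq[OF _ extension])
  note integral_arc_length[OF Y this]
  also have "integral {0..1} (\<lambda>\<rho>. norm (velocity Y \<rho>) * \<gamma> (normal Y (arc_length Y \<rho>)))
      = integral {0..1} (\<lambda>\<rho>. homogeneous_extension \<gamma> (- perp (velocity Y \<rho>)))"
    by (rule integral_cong)
       (simp add: normal_eq[OF Y arc_length_mem[OF Y]] param_of_arc_length[OF Y] homogeneous_extension_def)
  finally show ?thesis .
qed

text \<open>Homogeneity makes \<open>\<xi>\<close> constant in the normal direction, so \<open>\<partial>\<^sub>s\<xi>\<close> is tangential.\<close>

lemma has_vector_derivative_perp_xi:
  assumes \<gamma>: "surface_energy_density \<gamma>" and Y: "smooth_regular_open_curve Y"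
    and s: "s \<in> {0..curve_length Y}"
  obtains c where "((\<lambda>t. perp (xi \<gamma> Y t)) has_vector_derivative c *\<^sub>R normal Y s)
                     (at s within {0..curve_length Y})"
proof -
  define \<rho> where "\<rho> = param_of Y s"
  define p where "p = - perp (velocity Y \<rho>)"
  have \<rho>: "\<rho> \<in> {0..1}" unfolding \<rho>_def by (rule param_of_mem[OF Y s])
  have p: "p \<noteq> 0" using velocity_nonzero[OF Y \<rho>] by (simp add: p_def)
  obtain k where k: "(cahn_hoffman \<gamma> has_derivative (\<lambda>h. (k * (h \<bullet> perp p)) *\<^sub>R perp p)) (at p)"
    by (rule has_derivative_cahn_hoffman[OF \<gamma> p])
  define w where "w = velocity (velocity Y) \<rho>"
  have "((\<lambda>\<rho>. - perp (velocity Y \<rho>)) has_vector_derivative - perp w) (at \<rho> within {0..1})"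
    unfolding w_def
    by (intro has_vector_derivative_minus bounded_linear.has_vector_derivative[OF bounded_linear_perp]
        has_vector_derivative_velocity Y \<rho>)
  then have "((\<lambda>\<rho>. - perp (velocity Y \<rho>)) has_derivative (\<lambda>t. t *\<^sub>R - perp w)) (at \<rho> within {0..1})"
    by (simp only: has_vector_derivative_def)
  from has_derivative_compose[OF this k[unfolded p_def]]
  have "((\<lambda>\<rho>. cahn_hoffman \<gamma> (- perp (velocity Y \<rho>))) has_vector_derivative
      (k * (- perp w \<bullet> perp p)) *\<^sub>R perp p) (at \<rho> within {0..1})"
    unfolding has_vector_derivative_def p_def[symmetric]
    by (rule has_derivative_eq_rhs) (simp add: fun_eq_iff)
  \<comment> \<open>A second rotation takes the multiple of \<open>perp p\<close> to a multiple of
    \<open>p\<close>, which is parallel to the normal.\<close>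
  from bounded_linear.has_vector_derivative[OF bounded_linear_perp this]
  have "((\<lambda>\<rho>. perp (cahn_hoffman \<gamma> (- perp (velocity Y \<rho>)))) has_vector_derivative
      (- k * (- perp w \<bullet> perp p)) *\<^sub>R p) (at \<rho> within {0..1})"
    by simp
  from has_vector_derivative_along_curve[OF Y s this[unfolded \<rho>_def]]
  have derivative: "((\<lambda>t. perp (cahn_hoffman \<gamma> (- perp (velocity Y (param_of Y t))))) has_vector_derivative
      ((- k * (- perp w \<bullet> perp p)) *\<^sub>R p) /\<^sub>R norm (velocity Y \<rho>)) (at s within {0..curve_length Y})"
    by (simp only: \<rho>_def)
  have "((- k * (- perp w \<bullet> perp p)) *\<^sub>R p) /\<^sub>R norm (velocity Y \<rho>)
      = (- k * (- perp w \<bullet> perp p)) *\<^sub>R normal Y s"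
    by (simp add: normal_eq[OF Y s] p_def \<rho>_def)
  note derivative = derivative[unfolded this]
  have "perp (xi \<gamma> Y t) = perp (cahn_hoffman \<gamma> (- perp (velocity Y (param_of Y t))))"
    if "t \<in> {0..curve_length Y}" for t
    by (simp only: xi_eq[OF \<gamma> Y that])
  from has_vector_derivative_transform[OF s this derivative] show thesis
    by (rule that)
qed

section \<open>First variation of the energy of a single curve\<close>

context curve_family
begin

text \<open>Regularity of every curve keeps the argument of the extension away from the origin, so
  the chain rule applies. Skew-symmetry of \<open>perp\<close> moves the rotation onto
  \<xi>.\<close>

lemma first_variation_parametric:
  assumes \<gamma>: "surface_energy_density \<gamma>"
    and curves: "\<And>\<epsilon>. \<epsilon> \<in> {0..e} \<Longrightarrow> smooth_regular_open_curve (\<lambda>\<rho>. F \<rho> \<epsilon>)"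
  shows "((\<lambda>\<epsilon>. integral {0..1} (\<lambda>\<rho>. homogeneous_extension \<gamma> (- perp (F\<rho> \<rho> \<epsilon>)))) has_real_derivative
           integral {0..1} (\<lambda>\<rho>. perp (cahn_hoffman \<gamma> (- perp (F\<rho> \<rho> 0))) \<bullet> F\<rho>\<epsilon> \<rho> 0)) (at 0 within {0..e})"
proof -
  have nonzero: "F\<rho> \<rho> \<epsilon> \<noteq> 0" if "\<rho> \<in> {0..1}" "\<epsilon> \<in> {0..e}" for \<rho> \<epsilon>
    using velocity_nonzero[OF curves[OF that(2)] that(1)]
      vector_derivative_within_closed_interval[OF zero_less_one that(1) F\<rho>[OF that]] by simp
  note perp_cont = bounded_linear.continuous_on[OF bounded_linear_perp]
  have "((\<lambda>\<epsilon>. integral (cbox 0 1) (\<lambda>\<rho>. homogeneous_extension \<gamma> (- perp (F\<rho> \<rho> \<epsilon>)))) has_field_derivative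
      integral (cbox 0 1) (\<lambda>\<rho>. perp (cahn_hoffman \<gamma> (- perp (F\<rho> \<rho> 0))) \<bullet> F\<rho>\<epsilon> \<rho> 0)) (at 0 within {0..e})"
  proof (rule leibniz_rule_field_derivative)
    fix \<epsilon> \<rho> :: real assume "\<epsilon> \<in> {0..e}" "\<rho> \<in> cbox 0 1"
    then have mem: "\<rho> \<in> {0..1}" "\<epsilon> \<in> {0..e}" by simp_all
    have "((\<lambda>\<epsilon>. - perp (F\<rho> \<rho> \<epsilon>)) has_vector_derivative - perp (F\<rho>\<epsilon> \<rho> \<epsilon>)) (at \<epsilon> within {0..e})"
      by (intro has_vector_derivative_minus bounded_linear.has_vector_derivative[OF bounded_linear_perp]
          F\<rho>\<epsilon> mem)
    moreover have "- perp (F\<rho> \<rho> \<epsilon>) \<noteq> 0" using nonzero[OF mem] by simp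
    note GDERIV_homogeneous_extension[OF \<gamma> this]
    ultimately show "((\<lambda>\<epsilon>. homogeneous_extension \<gamma> (- perp (F\<rho> \<rho> \<epsilon>))) has_field_derivative
        perp (cahn_hoffman \<gamma> (- perp (F\<rho> \<rho> \<epsilon>))) \<bullet> F\<rho>\<epsilon> \<rho> \<epsilon>) (at \<epsilon> within {0..e})"
      unfolding has_vector_derivative_def gderiv_def has_field_derivative_def
      by (rule has_derivative_compose[THEN has_derivative_eq_rhs])
         (simp add: fun_eq_iff inner_commute inner_perp_right)
  next
    fix \<epsilon> assume "\<epsilon> \<in> {0..e}"
    have "continuous_on {0..1} (\<lambda>\<rho>. homogeneous_extension \<gamma> (- perp (F\<rho> \<rho> \<epsilon>)))"
      by (rule continuous_on_compose2[OF continuous_on_homogeneous_extension[OF \<gamma>] continuous_on_minus[OF perp_cont[OF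
              continuous_on_slice(1)[OF \<open>\<epsilon> \<in> {0..e}\<close>]]]])
         (use nonzero \<open>\<epsilon> \<in> {0..e}\<close> in auto)
    then show "(\<lambda>\<rho>. homogeneous_extension \<gamma> (- perp (F\<rho> \<rho> \<epsilon>))) integrable_on cbox 0 1"
      by (simp add: integrable_continuous_interval)
  next
    have "continuous_on ({0..e} \<times> {0..1}) (\<lambda>x. - perp (F\<rho> (snd x) (fst x)))"
      using continuous_on_swapped(1) by (intro continuous_on_minus perp_cont) (simp add: case_prod_unfold)
    then have "continuous_on ({0..e} \<times> {0..1}) (\<lambda>x. cahn_hoffman \<gamma> (- perp (F\<rho> (snd x) (fst x))))"
      by (rule continuous_on_compose2[OF continuous_on_cahn_hoffman[OF \<gamma>]]) (use nonzero in auto)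
    then have "continuous_on ({0..e} \<times> {0..1}) (\<lambda>x. perp (cahn_hoffman \<gamma> (- perp (F\<rho> (snd x) (fst x))))
        \<bullet> F\<rho>\<epsilon> (snd x) (fst x))"
      using continuous_on_swapped(2) by (intro continuous_on_inner perp_cont) (simp_all add: case_prod_unfold)
    then show "continuous_on ({0..e} \<times> cbox 0 1)
        (\<lambda>(\<epsilon>, \<rho>). perp (cahn_hoffman \<gamma> (- perp (F\<rho> \<rho> \<epsilon>))) \<bullet> F\<rho>\<epsilon> \<rho> \<epsilon>)"
      by (simp add: case_prod_unfold)
  qed (use e_pos in auto)
  then show ?thesis by simp
qed

text \<open>Both boundary terms are kept, because the cancellation at the junction involves all
  three curves.\<close>

lemma first_variation_curve:
  assumes \<gamma>: "surface_energy_density \<gamma>" and Y: "smooth_regular_open_curve Y"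
    and curves: "\<And>\<epsilon>. \<epsilon> \<in> {0..e} \<Longrightarrow> smooth_regular_open_curve (\<lambda>\<rho>. F \<rho> \<epsilon>)"
    and Y_eq: "\<And>\<rho>. \<rho> \<in> {0..1} \<Longrightarrow> F \<rho> 0 = Y \<rho>"
  defines "V \<equiv> \<lambda>s. vector_derivative (F (param_of Y s)) (at 0 within {0..e})"
    and "W \<equiv> \<lambda>Y. integral {0..curve_length Y} (\<lambda>s. \<gamma> (normal Y s))"
  shows "((\<lambda>\<epsilon>. (W (\<lambda>\<rho>. F \<rho> \<epsilon>) - W Y) / \<epsilon>) \<longlongrightarrow>
           perp (xi \<gamma> Y (curve_length Y)) \<bullet> V (curve_length Y) - perp (xi \<gamma> Y 0) \<bullet> V 0
           - integral {0..curve_length Y}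
               (\<lambda>s. (deriv_s Y (\<lambda>t. perp (xi \<gamma> Y t)) s \<bullet> normal Y s) * (V s \<bullet> normal Y s)))
         (at 0 within {0..e})"
proof -
  define L where "L = curve_length Y"
  have L: "0 < L" unfolding L_def by (rule curve_length_pos[OF Y])
  have zero: "0 \<in> {0..e}" using e_pos by simp
  have velocity_F: "velocity (\<lambda>\<rho>. F \<rho> \<epsilon>) \<rho> = F\<rho> \<rho> \<epsilon>" if "\<rho> \<in> {0..1}" "\<epsilon> \<in> {0..e}" for \<rho> \<epsilon>
    by (rule vector_derivative_within_closed_interval[OF zero_less_one that(1) F\<rho>[OF that]])
  \<comment> \<open>\<open>F\<close> at time 0 and \<open>Y\<close> are known to agree on the
    parameter interval only; this suffices because velocities are taken relative to it.\<close>
  have velocity_Y: "velocity Y \<rho> = F\<rho> \<rho> 0" if "\<rho> \<in> {0..1}" for \<rho>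
    by (rule vector_derivative_within_closed_interval[OF zero_less_one that
          has_vector_derivative_transform[OF that Y_eq[symmetric] F\<rho>[OF that zero]]])
  define E where "E = (\<lambda>\<epsilon>. integral {0..1} (\<lambda>\<rho>. homogeneous_extension \<gamma> (- perp (F\<rho> \<rho> \<epsilon>))))"
  have W_F: "W (\<lambda>\<rho>. F \<rho> \<epsilon>) = E \<epsilon>" if "\<epsilon> \<in> {0..e}" for \<epsilon>
    unfolding W_def E_def integral_density_eq[OF \<gamma> curves[OF that]]
    by (rule integral_cong) (simp only: velocity_F that)
  have W_Y: "W Y = E 0"
    unfolding W_def E_def integral_density_eq[OF \<gamma> Y]
    by (rule integral_cong) (simp only: velocity_Y)

  define f where "f = (\<lambda>s. perp (xi \<gamma> Y s))"
  define f' where "f' = deriv_s Y f"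
  define V' where "V' = (\<lambda>s. F\<rho>\<epsilon> (param_of Y s) 0 /\<^sub>R norm (velocity Y (param_of Y s)))"
  have f': "(f has_vector_derivative f' s) (at s within {0..L})"
    "f' s = (f' s \<bullet> normal Y s) *\<^sub>R normal Y s" if s: "s \<in> {0..L}" for s
  proof -
    obtain c where c: "(f has_vector_derivative c *\<^sub>R normal Y s) (at s within {0..L})"
      using has_vector_derivative_perp_xi[OF \<gamma> Y s[unfolded L_def]] unfolding f_def L_def by blast
    have f's: "f' s = c *\<^sub>R normal Y s"
      unfolding f'_def deriv_s_def L_def[symmetric]
      by (rule vector_derivative_within_closed_interval[OF L s c])
    with c show "(f has_vector_derivative f' s) (at s within {0..L})" by simp
    \<comment> \<open>The normal is a unit vector, so the coefficient \<open>c\<close> is recovered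
      as an inner product.\<close>
    show "f' s = (f' s \<bullet> normal Y s) *\<^sub>R normal Y s"
      using norm_normal[OF Y s[unfolded L_def]] by (simp add: f's dot_square_norm)
  qed
  have param: "param_of Y s \<in> {0..1}" if "s \<in> {0..L}" for s
    by (rule param_of_mem[OF Y that[unfolded L_def]])
  have V_eq: "V s = F\<epsilon> (param_of Y s) 0" if "s \<in> {0..L}" for s
    unfolding V_def by (rule vector_derivative_F\<epsilon>[OF param[OF that] zero])
  \<comment> \<open>The interchanged mixed partial enters here: divided by the speed it is the arc
    length derivative of \<open>V\<close>.\<close>
  have V': "(V has_vector_derivative V' s) (at s within {0..L})" if s: "s \<in> {0..L}" for s
    unfolding V'_def L_def
    by (rule has_vector_derivative_transform[OF s[unfolded L_def] V_eq[unfolded L_def]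
          has_vector_derivative_along_curve[OF Y s[unfolded L_def]
            has_vector_derivative_F\<epsilon>[OF param[OF s] zero]]])
  have cont_f: "continuous_on {0..L} f"
    by (rule continuous_on_vector_derivative[OF f'(1)])
  have "continuous_on {0..1} (\<lambda>\<rho>. F\<rho>\<epsilon> \<rho> 0 /\<^sub>R norm (velocity Y \<rho>))"
    by (intro continuous_intros continuous_on_slice(2)[OF zero] continuous_on_velocity[OF Y])
       (use velocity_nonzero[OF Y] in auto)
  from continuous_on_along_curve[OF Y this] have cont_V': "continuous_on {0..L} V'"
    unfolding V'_def L_def .
  \<comment> \<open>The speed produced by the substitution cancels the division by the speed in
    \<open>V'\<close>.\<close>
  have "integral {0..1} (\<lambda>\<rho>. perp (cahn_hoffman \<gamma> (- perp (F\<rho> \<rho> 0))) \<bullet> F\<rho>\<epsilon> \<rho> 0)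
      = integral {0..1} (\<lambda>\<rho>. norm (velocity Y \<rho>) * (f (arc_length Y \<rho>) \<bullet> V' (arc_length Y \<rho>)))"
  proof (rule integral_cong)
    fix \<rho> :: real assume \<rho>: "\<rho> \<in> {0..1}"
    have f_\<rho>: "f (arc_length Y \<rho>) = perp (cahn_hoffman \<gamma> (- perp (F\<rho> \<rho> 0)))"
      unfolding f_def xi_eq[OF \<gamma> Y arc_length_mem[OF Y \<rho>]] param_of_arc_length[OF Y \<rho>]
        velocity_Y[OF \<rho>] ..
    show "perp (cahn_hoffman \<gamma> (- perp (F\<rho> \<rho> 0))) \<bullet> F\<rho>\<epsilon> \<rho> 0
        = norm (velocity Y \<rho>) * (f (arc_length Y \<rho>) \<bullet> V' (arc_length Y \<rho>))"
      using velocity_nonzero[OF Y \<rho>] by (simp add: f_\<rho> V'_def param_of_arc_length[OF Y \<rho>])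
  qed
  also have "\<dots> = integral {0..L} (\<lambda>s. f s \<bullet> V' s)"
    unfolding L_def
    by (rule integral_arc_length[OF Y, symmetric])
       (intro continuous_on_inner cont_f[unfolded L_def] cont_V'[unfolded L_def])
  finally have derivative: "(E has_real_derivative integral {0..L} (\<lambda>s. f s \<bullet> V' s)) (at 0 within {0..e})"
    using first_variation_parametric[OF \<gamma> curves] unfolding E_def by simp

  \<comment> \<open>Integration by parts is the fundamental theorem applied to the product
    \<open>f s \<bullet> V s\<close>.\<close>
  have product: "((\<lambda>s. f s \<bullet> V' s + f' s \<bullet> V s) has_integral f L \<bullet> V L - f 0 \<bullet> V 0) {0..L}"
    by (rule fundamental_theorem_of_calculus[OF less_imp_le[OF L]
          bounded_bilinear.has_vector_derivative[OF bounded_bilinear_inner f'(1) V']])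
  have "((\<lambda>s. f s \<bullet> V' s) has_integral integral {0..L} (\<lambda>s. f s \<bullet> V' s)) {0..L}"
    by (intro integrable_integral integrable_continuous_interval continuous_on_inner cont_f cont_V')
  from has_integral_diff[OF product this]
  have "((\<lambda>s. f' s \<bullet> V s) has_integral
      f L \<bullet> V L - f 0 \<bullet> V 0 - integral {0..L} (\<lambda>s. f s \<bullet> V' s)) {0..L}"
    by (simp only: add_diff_cancel_left')
  then have "integral {0..L} (\<lambda>s. f' s \<bullet> V s) = f L \<bullet> V L - f 0 \<bullet> V 0 - integral {0..L} (\<lambda>s. f s \<bullet> V' s)"
    by (rule integral_unique)
  \<comment> \<open>As \<open>f'\<close> is normal to the curve, only the normal component of
    \<open>V\<close> contributes.\<close>
  moreover have "integral {0..L} (\<lambda>s. f' s \<bullet> V s)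
      = integral {0..L} (\<lambda>s. (f' s \<bullet> normal Y s) * (V s \<bullet> normal Y s))"
  proof (rule integral_cong)
    fix s assume "s \<in> {0..L}"
    from arg_cong[OF f'(2)[OF this], of "\<lambda>v. v \<bullet> V s"]
    show "f' s \<bullet> V s = (f' s \<bullet> normal Y s) * (V s \<bullet> normal Y s)"
      by (simp add: inner_commute)
  qed
  ultimately have parts: "integral {0..L} (\<lambda>s. f s \<bullet> V' s) = f L \<bullet> V L - f 0 \<bullet> V 0
      - integral {0..L} (\<lambda>s. (f' s \<bullet> normal Y s) * (V s \<bullet> normal Y s))"
    by simp

  have "((\<lambda>\<epsilon>. (E \<epsilon> - E 0) / \<epsilon>) \<longlongrightarrow> integral {0..L} (\<lambda>s. f s \<bullet> V' s)) (at 0 within {0..e})"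
    using derivative by (simp add: has_field_derivative_iff)
  \<comment> \<open>The filter only sees parameters in \<open>{0..e}\<close>, where the two forms of
    the energy agree.\<close>
  moreover have "\<forall>\<^sub>F \<epsilon> in at 0 within {0..e}. (E \<epsilon> - E 0) / \<epsilon> = (W (\<lambda>\<rho>. F \<rho> \<epsilon>) - W Y) / \<epsilon>"
    unfolding eventually_at_filter by (rule always_eventually) (simp add: W_F W_Y)
  ultimately have "((\<lambda>\<epsilon>. (W (\<lambda>\<rho>. F \<rho> \<epsilon>) - W Y) / \<epsilon>) \<longlongrightarrow> integral {0..L} (\<lambda>s. f s \<bullet> V' s)) (at 0 within {0..e})"
    by (rule Lim_transform_eventually)
  then show ?thesis
    unfolding parts unfolding f'_def f_def L_def .
qed

end

section \<open>Junction vectors and assembly of the three curves\<close>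

lemma perp_eq_frame:
  fixes x \<tau> :: "real^2"
  assumes "norm \<tau> = 1"
  shows "perp x = (x \<bullet> - perp \<tau>) *\<^sub>R \<tau> - (x \<bullet> \<tau>) *\<^sub>R - perp \<tau>"
proof -
  have \<tau>: "\<tau> $ 1 * \<tau> $ 1 + \<tau> $ 2 * \<tau> $ 2 = 1"
    using assms by (simp add: norm_eq_1 inner_plane)
  \<comment> \<open>With n = \<open>- perp \<tau>\<close>, the pair of \<tau> and n is an
    orthonormal frame, and \<open>perp\<close> maps n to \<tau> and \<tau> to -n. These are the two
    coordinates of the expansion of x in this frame after rotation.\<close>
  have "(x \<bullet> - perp \<tau>) * \<tau> $ 1 + (x \<bullet> \<tau>) * \<tau> $ 2 = x $ 2 * (\<tau> $ 1 * \<tau> $ 1 + \<tau> $ 2 * \<tau> $ 2)"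
    "(x \<bullet> - perp \<tau>) * \<tau> $ 2 - (x \<bullet> \<tau>) * \<tau> $ 1 = - x $ 1 * (\<tau> $ 1 * \<tau> $ 1 + \<tau> $ 2 * \<tau> $ 2)"
    by (simp_all add: inner_plane algebra_simps)
  then show ?thesis
    unfolding \<tau> by (simp add: vec_eq_iff forall_2)
qed

text \<open>In the frame of tangent and normal, Euler's identity turns the normal component of \<xi>
  into \<open>\<gamma>\<close>. The right-hand side is a summand of the junction condition.\<close>

lemma perp_xi_eq:
  assumes \<gamma>: "surface_energy_density \<gamma>" and Y: "smooth_regular_open_curve Y"
    and s: "s \<in> {0..curve_length Y}"
  shows "perp (xi \<gamma> Y s) = \<gamma> (normal Y s) *\<^sub>R tangent Y s
           - (cahn_hoffman \<gamma> (normal Y s) \<bullet> tangent Y s) *\<^sub>R normal Y s"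
  using perp_eq_frame[OF norm_tangent[OF Y s], of "xi \<gamma> Y s"]
  unfolding xi_def normal_def[symmetric] inner_cahn_hoffman_self[OF \<gamma> norm_normal[OF Y s]] .

theorem theorem2p1:
  fixes \<Gamma> :: "3 \<Rightarrow> real \<Rightarrow> real^2"
    and \<gamma> :: "3 \<Rightarrow> real^2 \<Rightarrow> real"
    and \<gamma>VS1 \<gamma>F1S1 \<gamma>VS2 \<gamma>F2S2 :: real
    and \<epsilon>0 :: real
    and X :: "3 \<Rightarrow> real \<Rightarrow> real \<Rightarrow> real^2"
  assumes density: "\<And>j. surface_energy_density (\<gamma> j)"
    and bubble: "double_bubble \<Gamma>"
    and perturbation: "smooth_perturbation \<Gamma> \<epsilon>0 X"
    and junction:
      "(\<Sum>j\<in>UNIV. let L = curve_length (\<Gamma> j); n = normal (\<Gamma> j) L; \<tau> = tangent (\<Gamma> j) L in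
          \<gamma> j n *\<^sub>R \<tau> - (cahn_hoffman (\<gamma> j) n \<bullet> \<tau>) *\<^sub>R n) = 0"
  shows
    "((\<lambda>\<epsilon>. (bubble_energy \<gamma> \<gamma>VS1 \<gamma>F1S1 \<gamma>VS2 \<gamma>F2S2 (\<lambda>j \<rho>. X j \<rho> \<epsilon>)
              - bubble_energy \<gamma> \<gamma>VS1 \<gamma>F1S1 \<gamma>VS2 \<gamma>F2S2 \<Gamma>) / \<epsilon>)
      \<longlongrightarrow>
        - (\<Sum>j\<in>UNIV. integral {0..curve_length (\<Gamma> j)}
             (\<lambda>s. (deriv_s (\<Gamma> j) (\<lambda>t. perp (xi (\<gamma> j) (\<Gamma> j) t)) s \<bullet> normal (\<Gamma> j) s)
                  * (V0 \<Gamma> \<epsilon>0 X j s \<bullet> normal (\<Gamma> j) s)))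
        - (xi (\<gamma> 1) (\<Gamma> 1) 0 $ 2 - (\<gamma>VS1 - \<gamma>F1S1)) * (V0 \<Gamma> \<epsilon>0 X 1 0 \<bullet> axis 1 1)
        - (xi (\<gamma> 2) (\<Gamma> 2) 0 $ 2 + (\<gamma>VS2 - \<gamma>F2S2)) * (V0 \<Gamma> \<epsilon>0 X 2 0 \<bullet> axis 1 1)
        - (xi (\<gamma> 3) (\<Gamma> 3) 0 $ 2 + (\<gamma>VS1 - \<gamma>F1S1) - (\<gamma>VS2 - \<gamma>F2S2)) * (V0 \<Gamma> \<epsilon>0 X 3 0 \<bullet> axis 1 1))
     (at_right 0)"
proof -
  define V where "V = V0 \<Gamma> \<epsilon>0 X"
  define L where "L = (\<lambda>j. curve_length (\<Gamma> j))"
  define W where "W = (\<lambda>j Y. integral {0..curve_length Y} (\<lambda>s. \<gamma> j (normal Y s)))"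
  define I where "I = (\<lambda>j. integral {0..L j}
    (\<lambda>s. (deriv_s (\<Gamma> j) (\<lambda>t. perp (xi (\<gamma> j) (\<Gamma> j) t)) s \<bullet> normal (\<Gamma> j) s) * (V j s \<bullet> normal (\<Gamma> j) s)))"
  define a where "a = \<gamma>VS1 - \<gamma>F1S1"
  define b where "b = \<gamma>VS2 - \<gamma>F2S2"
  have \<epsilon>0: "0 < \<epsilon>0"
    and smooth: "\<And>j. smooth_on (\<lambda>(\<rho>, \<epsilon>). X j \<rho> \<epsilon>) ({0..1} \<times> {0..\<epsilon>0})"
    and X_0: "\<And>j \<rho>. \<rho> \<in> {0..1} \<Longrightarrow> X j \<rho> 0 = \<Gamma> j \<rho>"
    and bubbles: "\<And>\<epsilon>. \<epsilon> \<in> {0..\<epsilon>0} \<Longrightarrow> double_bubble (\<lambda>j \<rho>. X j \<rho> \<epsilon>)"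
    using perturbation unfolding smooth_perturbation_def by blast+
  have zero: "0 \<in> {0..\<epsilon>0}" using \<epsilon>0 by simp
  have curve: "smooth_regular_open_curve (\<Gamma> j)" for j
    using bubble unfolding double_bubble_def by blast
  have curves: "smooth_regular_open_curve (\<lambda>\<rho>. X j \<rho> \<epsilon>)" if "\<epsilon> \<in> {0..\<epsilon>0}" for j \<epsilon>
    using bubbles[OF that] unfolding double_bubble_def by blast
  have substrate: "X j 0 \<epsilon> $ 2 = 0" if "\<epsilon> \<in> {0..\<epsilon>0}" for j \<epsilon>
    using bubbles[OF that] unfolding double_bubble_def by blast
  have junction_point: "X j 1 \<epsilon> = X i 1 \<epsilon>" if "\<epsilon> \<in> {0..\<epsilon>0}" for i j \<epsilon>
    using bubbles[OF that] unfolding double_bubble_def by metis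

  \<comment> \<open>One-sided derivatives at 0 are unique, so any derivative exhibited for the
    motion of the point is \<open>V j s\<close>.\<close>
  have V_unique: "V j s = v"
    if "(X j (param_of (\<Gamma> j) s) has_vector_derivative v) (at 0 within {0..\<epsilon>0})" for j s v
    unfolding V_def V0_def deformation_field_def
    by (rule vector_derivative_within_closed_interval[OF \<epsilon>0 zero that])
  have X_deriv: "(X j (param_of (\<Gamma> j) s) has_vector_derivative V j s) (at 0 within {0..\<epsilon>0})"
    if "s \<in> {0..L j}" for j s
  proof -
    obtain F\<rho> F\<epsilon> F\<rho>\<epsilon> where "curve_family (X j) \<epsilon>0 F\<rho> F\<epsilon> F\<rho>\<epsilon>"
      by (rule curve_familyE[OF smooth \<epsilon>0])
    from curve_family.F\<epsilon>[OF this param_of_mem[OF curve that[unfolded L_def]] zero]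
    show ?thesis using V_unique by metis
  qed
  have L_pos: "0 < L j" for j unfolding L_def by (rule curve_length_pos[OF curve])
  then have ends: "0 \<in> {0..L j}" "L j \<in> {0..L j}" for j by (simp_all add: less_imp_le)
  have X_deriv_0: "(X j 0 has_vector_derivative V j 0) (at 0 within {0..\<epsilon>0})" for j
    using X_deriv[OF ends(1), of j] by (simp only: param_of_0[OF curve])
  have X_deriv_1: "(X j 1 has_vector_derivative V j (L j)) (at 0 within {0..\<epsilon>0})" for j
    using X_deriv[OF ends(2), of j] unfolding L_def by (simp only: param_of_curve_length[OF curve])
  \<comment> \<open>The three end points move along the same path, so their initial velocities are
    equal.\<close>
  have V_junction: "V j (L j) = V 1 (L 1)" for j
    by (rule V_unique) (unfold L_def param_of_curve_length[OF curve],
      rule has_vector_derivative_transform[OF zero junction_point X_deriv_1[of 1, unfolded L_def]])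
  have quotient: "((\<lambda>\<epsilon>. (X j 0 \<epsilon> $ i - \<Gamma> j 0 $ i) / \<epsilon>) \<longlongrightarrow> V j 0 $ i) (at 0 within {0..\<epsilon>0})" for i j
  proof -
    have "((\<lambda>\<epsilon>. X j 0 \<epsilon> $ i) has_real_derivative V j 0 $ i) (at 0 within {0..\<epsilon>0})"
      using bounded_linear.has_vector_derivative[OF bounded_linear_vec_nth X_deriv_0]
      by (simp add: has_real_derivative_iff_has_vector_derivative)
    then show ?thesis
      using X_0[of 0 j] by (simp add: has_field_derivative_iff)
  qed
  \<comment> \<open>The second coordinate of a contact point vanishes for every parameter, hence so
    does its derivative.\<close>
  have V_horizontal: "V j 0 $ 2 = 0" for j
  proof -
    have "((\<lambda>\<epsilon>. X j 0 \<epsilon> $ 2) has_vector_derivative V j 0 $ 2) (at 0 within {0..\<epsilon>0})"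
      by (rule bounded_linear.has_vector_derivative[OF bounded_linear_vec_nth X_deriv_0])
    moreover have "((\<lambda>\<epsilon>. X j 0 \<epsilon> $ 2) has_vector_derivative 0) (at 0 within {0..\<epsilon>0})"
      by (rule has_vector_derivative_transform[OF zero substrate has_vector_derivative_const])
    ultimately show ?thesis
      using vector_derivative_within_closed_interval[OF \<epsilon>0 zero] by metis
  qed
  have contact: "perp v \<bullet> V j 0 = v $ 2 * V j 0 $ 1" for j v
    by (simp add: inner_plane V_horizontal)

  \<comment> \<open>The junction velocity is written as the common vector \<open>V 1 (L 1)\<close>,
    so that it can be factored out of the sum over the curves.\<close>
  have variation: "((\<lambda>\<epsilon>. (W j (\<lambda>\<rho>. X j \<rho> \<epsilon>) - W j (\<Gamma> j)) / \<epsilon>) \<longlongrightarrow>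
      perp (xi (\<gamma> j) (\<Gamma> j) (L j)) \<bullet> V 1 (L 1) - xi (\<gamma> j) (\<Gamma> j) 0 $ 2 * V j 0 $ 1 - I j)
      (at 0 within {0..\<epsilon>0})" for j
  proof -
    obtain F\<rho> F\<epsilon> F\<rho>\<epsilon> where "curve_family (X j) \<epsilon>0 F\<rho> F\<epsilon> F\<rho>\<epsilon>"
      by (rule curve_familyE[OF smooth \<epsilon>0])
    from curve_family.first_variation_curve[OF this density[of j] curve[of j] curves X_0]
    have "((\<lambda>\<epsilon>. (W j (\<lambda>\<rho>. X j \<rho> \<epsilon>) - W j (\<Gamma> j)) / \<epsilon>) \<longlongrightarrow>
      perp (xi (\<gamma> j) (\<Gamma> j) (L j)) \<bullet> V j (L j) - perp (xi (\<gamma> j) (\<Gamma> j) 0) \<bullet> V j 0 - I j)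
      (at 0 within {0..\<epsilon>0})"
      unfolding W_def I_def L_def V_def V0_def deformation_field_def .
    then show ?thesis by (simp only: V_junction[of j] contact)
  qed

  have energy: "bubble_energy \<gamma> \<gamma>VS1 \<gamma>F1S1 \<gamma>VS2 \<gamma>F2S2 Y = (\<Sum>j\<in>UNIV. W j (Y j))
      - a * (Y 3 0 $ 1 - Y 1 0 $ 1) - b * (Y 2 0 $ 1 - Y 3 0 $ 1)" for Y
    unfolding bubble_energy_def Let_def W_def a_def b_def ..
  \<comment> \<open>The junction condition says precisely that the rotated vectors \<xi>
    balance.\<close>
  have "(\<Sum>j\<in>UNIV. perp (xi (\<gamma> j) (\<Gamma> j) (L j))) = 0"
    using junction
    unfolding Let_def L_def perp_xi_eq[OF density curve ends(2)[unfolded L_def]] .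
  then have balance: "(\<Sum>j\<in>UNIV. perp (xi (\<gamma> j) (\<Gamma> j) (L j)) \<bullet> V 1 (L 1)) = 0"
    unfolding inner_sum_left[symmetric] by simp

  have "((\<lambda>\<epsilon>. (\<Sum>j\<in>UNIV. (W j (\<lambda>\<rho>. X j \<rho> \<epsilon>) - W j (\<Gamma> j)) / \<epsilon>)
      - a * ((X 3 0 \<epsilon> $ 1 - \<Gamma> 3 0 $ 1) / \<epsilon> - (X 1 0 \<epsilon> $ 1 - \<Gamma> 1 0 $ 1) / \<epsilon>)
      - b * ((X 2 0 \<epsilon> $ 1 - \<Gamma> 2 0 $ 1) / \<epsilon> - (X 3 0 \<epsilon> $ 1 - \<Gamma> 3 0 $ 1) / \<epsilon>)) \<longlongrightarrow>
      (\<Sum>j\<in>UNIV. perp (xi (\<gamma> j) (\<Gamma> j) (L j)) \<bullet> V 1 (L 1) - xi (\<gamma> j) (\<Gamma> j) 0 $ 2 * V j 0 $ 1 - I j)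
      - a * (V 3 0 $ 1 - V 1 0 $ 1) - b * (V 2 0 $ 1 - V 3 0 $ 1)) (at 0 within {0..\<epsilon>0})"
    by (intro tendsto_intros variation quotient)
  \<comment> \<open>With the junction terms gone, each contact point collects its share of the
    wetting terms. The abscissa of C occurs in both wetting differences, so its coefficient contains
    both \<open>a\<close> and \<open>b\<close>.\<close>
  moreover have "(\<Sum>j\<in>UNIV. perp (xi (\<gamma> j) (\<Gamma> j) (L j)) \<bullet> V 1 (L 1) - xi (\<gamma> j) (\<Gamma> j) 0 $ 2 * V j 0 $ 1 - I j)
      - a * (V 3 0 $ 1 - V 1 0 $ 1) - b * (V 2 0 $ 1 - V 3 0 $ 1)
    = - (\<Sum>j\<in>UNIV. I j)
      - (xi (\<gamma> 1) (\<Gamma> 1) 0 $ 2 - a) * (V 1 0 \<bullet> axis 1 1)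
      - (xi (\<gamma> 2) (\<Gamma> 2) 0 $ 2 + b) * (V 2 0 \<bullet> axis 1 1)
      - (xi (\<gamma> 3) (\<Gamma> 3) 0 $ 2 + a - b) * (V 3 0 \<bullet> axis 1 1)"
    unfolding sum_subtractf balance by (simp add: sum_3 inner_axis algebra_simps)
  moreover have "(\<lambda>\<epsilon>. (\<Sum>j\<in>UNIV. (W j (\<lambda>\<rho>. X j \<rho> \<epsilon>) - W j (\<Gamma> j)) / \<epsilon>)
      - a * ((X 3 0 \<epsilon> $ 1 - \<Gamma> 3 0 $ 1) / \<epsilon> - (X 1 0 \<epsilon> $ 1 - \<Gamma> 1 0 $ 1) / \<epsilon>)
      - b * ((X 2 0 \<epsilon> $ 1 - \<Gamma> 2 0 $ 1) / \<epsilon> - (X 3 0 \<epsilon> $ 1 - \<Gamma> 3 0 $ 1) / \<epsilon>))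
    = (\<lambda>\<epsilon>. (bubble_energy \<gamma> \<gamma>VS1 \<gamma>F1S1 \<gamma>VS2 \<gamma>F2S2 (\<lambda>j \<rho>. X j \<rho> \<epsilon>)
              - bubble_energy \<gamma> \<gamma>VS1 \<gamma>F1S1 \<gamma>VS2 \<gamma>F2S2 \<Gamma>) / \<epsilon>)"
    unfolding energy sum_3 by (rule ext) (simp only: divide_inverse algebra_simps)
  \<comment> \<open>Near 0 the closed parameter interval and the open right half line define the
    same punctured filter.\<close>
  ultimately show ?thesis
    unfolding at_within_Icc_at_right[OF \<epsilon>0] unfolding I_def L_def V_def a_def b_def
    by (simp only:)
qed

end
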